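(* Let $G=(V,E)$ be a graph and let $J_G\subseteq R_G$ be the ideal generated by the fundamental binomials $F_G$ of $G$. Then $b_{E_1,E_2}\in J_G$ for every zig-zag pair $(E_1,E_2)$ of $G$. In particular, the toric ideal $I_{\mathcal{C}_G}$ is generated by \[ F_G\cup\{b_{E_1,E_2} : (E_1,E_2)\text{ is a cyclic pair of } G\}. \]
   Context: A graph $G=(V,E)$ is a finite undirected graph with vertex set $V$ and finite multiset $E$ of edges (multiple edges and loops allowed), without isolated vertices. Let $R_G$ be the polynomial ring over a field $K$ in the variables: $z_k$ for each $k\in V\cup E$; $y_{ijf}$ and $y_{jif}$ for each edge $f\in E$ with endpoints $i,j$; and $t_f$ for each $f\in E$. The toric ideal $I_{\mathcal{C}_G}$ is the kernel of the $K$-algebra homomorphism $R_G\to K[w_k^{\pm1}:k\in V\cup E]$ with $z_k\mapsto w_k$, $y_{ijf}\mapsto w_iw_j^{-1}w_f$, $y_{jif}\mapsto w_i^{-1}w_jw_f$, $t_f\mapsto w_iw_jw_f^{-1}$. For an edge $f$ with endpoints $i,j$ directed as $i\to j$, $y_{ijf}$ is the associated $y$-variable. The fundamental binomials are $F_G=\{y_{ijf}y_{jif}-z_f^2,\ y_{ijf}t_f-z_i^2,\ y_{jif}t_f-z_j^2,\ y_{ijf}z_j-z_iz_f,\ y_{jif}z_i-z_jz_f,\ t_fz_f-z_iz_j : f=ij\in E\}$. Zig-zag pair: given vertices $u,v$ and a path $P$ in $G$ from $u$ to $v$ of length at least $2$, and a partition $E(P)=P_1\cup P_2$ such that $P_1$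 contains the edge of $P$ incident to $u$ and $P_2$ contains the edge of $P$ incident to $v$, let $E_1$ be the edges of $P_1$ directed towards $v$ and $E_2$ the edges of $P_2$ directed towards $u$; its zig-zag binomial is $b_{E_1,E_2}=z_v\prod_{f=i\to j\in E_1}y_{ijf}\prod_{f\in E_2}z_f-z_u\prod_{f=i\to j\in E_2}y_{ijf}\prod_{f\in E_1}z_f$. Cyclic pair: given a cycle $C$ of $G$ with a fixed cyclic orientation and a partition $E(C)=C_1\cup C_2$ (one block possibly empty), let $E_1$ be the edges of $C_1$ directed along the orientation and $E_2$ the edges of $C_2$ directed against it; its cyclic binomial is $b_{E_1,E_2}=\prod_{f=i\to j\in E_1}y_{ijf}\prod_{f\in E_2}z_f-\prod_{f=i\to j\in E_2}y_{ijf}\prod_{f\in E_1}z_f$. *)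

theory Defs
  imports "HOL-Library.Poly_Mapping" "HOL-Library.Multiset" "HOL-Algebra.RingHom"
begin

section \<open>Multigraphs\<close>

text \<open>
  Edges carry their own identity, so parallel edges are distinct elements of \<open>edges G\<close> with
  the same endpoints. The endpoints of an edge form a multiset of size two; a loop at \<open>i\<close> has
  endpoints \<open>{#i, i#}\<close>.
\<close>

record ('v, 'e) multigraph =
  verts :: "'v set"
  edges :: "'e set"
  ends  :: "'e \<Rightarrow> 'v multiset"

definition is_graph :: "('v, 'e) multigraph \<Rightarrow> bool" where
  "is_graph G \<longleftrightarrow>
     finite (verts G) \<and> finite (edges G) \<and>
     (\<forall>f\<in>edges G. size (ends G f) = 2 \<and> set_mset (ends G f) \<subseteq> verts G) \<and>
     (\<forall>v\<in>verts G. \<exists>f\<in>edges G. v \<in># ends G f)"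

definition is_path :: "('v, 'e) multigraph \<Rightarrow> 'v list \<Rightarrow> 'e list \<Rightarrow> bool" where
  "is_path G vs es \<longleftrightarrow>
     length vs = Suc (length es) \<and> distinct vs \<and>
     set vs \<subseteq> verts G \<and> set es \<subseteq> edges G \<and>
     (\<forall>k<length es. ends G (es ! k) = {#vs ! k, vs ! Suc k#})"

text \<open>
  A cycle together with a cyclic orientation: the edge \<open>es ! k\<close> is traversed from \<open>vs ! k\<close> to
  the cyclically next vertex. Loops are cycles of length one and pairs of parallel edges are
  cycles of length two; distinctness of \<open>es\<close> only matters in length two, where it prevents
  running back along the same edge.
\<close>

definition is_cycle :: "('v, 'e) multigraph \<Rightarrow> 'v list \<Rightarrow> 'e list \<Rightarrow> bool" where
  "is_cycle G vs es \<longleftrightarrow>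
     es \<noteq> [] \<and> length vs = length es \<and> distinct vs \<and> distinct es \<and>
     set vs \<subseteq> verts G \<and> set es \<subseteq> edges G \<and>
     (\<forall>k<length es. ends G (es ! k) = {#vs ! k, vs ! (Suc k mod length vs)#})"


section \<open>Zig-zag pairs and cyclic pairs\<close>

text \<open>A triple \<open>(i, j, f)\<close> stands for the edge \<open>f\<close> directed as \<open>i \<rightarrow> j\<close>.\<close>

type_synonym ('v, 'e) dedge = "'v \<times> 'v \<times> 'e"

definition zigzag_pair ::
  "('v, 'e) multigraph \<Rightarrow> 'v \<Rightarrow> 'v \<Rightarrow> ('v, 'e) dedge set \<Rightarrow> ('v, 'e) dedge set \<Rightarrow> bool" where
  "zigzag_pair G u v E\<^sub>1 E\<^sub>2 \<longleftrightarrow>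
     (\<exists>vs es P\<^sub>1 P\<^sub>2.
        is_path G vs es \<and> hd vs = u \<and> last vs = v \<and> 2 \<le> length es \<and>
        P\<^sub>1 \<union> P\<^sub>2 = set es \<and> P\<^sub>1 \<inter> P\<^sub>2 = {} \<and> hd es \<in> P\<^sub>1 \<and> last es \<in> P\<^sub>2 \<and>
        E\<^sub>1 = {(vs ! k, vs ! Suc k, es ! k) | k. k < length es \<and> es ! k \<in> P\<^sub>1} \<and>
        E\<^sub>2 = {(vs ! Suc k, vs ! k, es ! k) | k. k < length es \<and> es ! k \<in> P\<^sub>2})"

definition cyclic_pair ::
  "('v, 'e) multigraph \<Rightarrow> ('v, 'e) dedge set \<Rightarrow> ('v, 'e) dedge set \<Rightarrow> bool" where
  "cyclic_pair G E\<^sub>1 E\<^sub>2 \<longleftrightarrow>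
     (\<exists>vs es C\<^sub>1 C\<^sub>2.
        is_cycle G vs es \<and>
        C\<^sub>1 \<union> C\<^sub>2 = set es \<and> C\<^sub>1 \<inter> C\<^sub>2 = {} \<and>
        E\<^sub>1 = {(vs ! k, vs ! (Suc k mod length vs), es ! k) | k. k < length es \<and> es ! k \<in> C\<^sub>1} \<and>
        E\<^sub>2 = {(vs ! (Suc k mod length vs), vs ! k, es ! k) | k. k < length es \<and> es ! k \<in> C\<^sub>2})"


section \<open>Polynomials and Laurent polynomials\<close>

text \<open>
  \<open>('x \<Rightarrow>\<^sub>0 nat) \<Rightarrow>\<^sub>0 'k\<close> is the polynomial ring and \<open>('x \<Rightarrow>\<^sub>0 int) \<Rightarrow>\<^sub>0 'k\<close> the Laurent polynomial
  ring in all variables of type \<open>'x\<close>; \<open>ring_in A\<close> is the subring of those elements that only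
  involve variables from \<open>A\<close>.
\<close>

definition ring_in :: "'x set \<Rightarrow> (('x \<Rightarrow>\<^sub>0 'n::comm_monoid_add) \<Rightarrow>\<^sub>0 'k::comm_ring_1) ring" where
  "ring_in A = \<lparr>carrier = {p. \<forall>m\<in>Poly_Mapping.keys p. Poly_Mapping.keys m \<subseteq> A},
                monoid.mult = (*), one = 1, ring.zero = 0, add = (+)\<rparr>"

definition Var :: "'x \<Rightarrow> (('x \<Rightarrow>\<^sub>0 nat) \<Rightarrow>\<^sub>0 'k::comm_ring_1)" where
  "Var x = Poly_Mapping.single (Poly_Mapping.single x 1) 1"

definition W :: "'x \<Rightarrow> (('x \<Rightarrow>\<^sub>0 int) \<Rightarrow>\<^sub>0 'k::comm_ring_1)" where
  "W k = Poly_Mapping.single (Poly_Mapping.single k 1) 1"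

definition W_inv :: "'x \<Rightarrow> (('x \<Rightarrow>\<^sub>0 int) \<Rightarrow>\<^sub>0 'k::comm_ring_1)" where
  "W_inv k = Poly_Mapping.single (Poly_Mapping.single k (- 1)) 1"

text \<open>
  The \<open>'k\<close>-algebra homomorphism into a Laurent polynomial ring that substitutes \<open>g x\<close> for each
  variable \<open>x\<close>.
\<close>

definition subst_hom ::
  "('x \<Rightarrow> (('y \<Rightarrow>\<^sub>0 int) \<Rightarrow>\<^sub>0 'k::comm_ring_1)) \<Rightarrow> (('x \<Rightarrow>\<^sub>0 nat) \<Rightarrow>\<^sub>0 'k) \<Rightarrow> (('y \<Rightarrow>\<^sub>0 int) \<Rightarrow>\<^sub>0 'k)" where
  "subst_hom g p =
     (\<Sum>m\<in>Poly_Mapping.keys p. Poly_Mapping.single 0 (Poly_Mapping.lookup p m) *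
        (\<Prod>x\<in>Poly_Mapping.keys m. g x ^ Poly_Mapping.lookup m x))"


section \<open>The ring of a graph, its toric ideal and the binomials\<close>

text \<open>
  \<open>ZV i\<close> and \<open>ZE f\<close> are the variables \<open>z\<^sub>k\<close> for a vertex and an edge, respectively. A loop \<open>f\<close> at
  \<open>i\<close> has the single \<open>y\<close>-variable \<open>Y i i f\<close>.
\<close>

datatype ('v, 'e) gvar = ZV 'v | ZE 'e | Y 'v 'v 'e | T 'e

definition gvars :: "('v, 'e) multigraph \<Rightarrow> ('v, 'e) gvar set" where
  "gvars G = ZV ` verts G \<union> ZE ` edges G
           \<union> {Y i j f | i j f. f \<in> edges G \<and> ends G f = {#i, j#}}
           \<union> T ` edges G"

type_synonym ('v, 'e, 'k) gpoly = "(('v, 'e) gvar \<Rightarrow>\<^sub>0 nat) \<Rightarrow>\<^sub>0 'k"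

definition graph_ring :: "('v, 'e) multigraph \<Rightarrow> ('v, 'e, 'k::field) gpoly ring" where
  "graph_ring G = ring_in (gvars G)"

text \<open>The disjoint union of vertices and edges indexes the Laurent variables \<open>w\<^sub>k\<close>.\<close>

definition laurent_ring ::
  "('v, 'e) multigraph \<Rightarrow> (('v + 'e \<Rightarrow>\<^sub>0 int) \<Rightarrow>\<^sub>0 'k::field) ring" where
  "laurent_ring G = ring_in (verts G <+> edges G)"

fun gvar_image :: "('v, 'e) multigraph \<Rightarrow> ('v, 'e) gvar \<Rightarrow> (('v + 'e \<Rightarrow>\<^sub>0 int) \<Rightarrow>\<^sub>0 'k::field)" where
  "gvar_image G (ZV i) = W (Inl i)"
| "gvar_image G (ZE f) = W (Inr f)"
| "gvar_image G (Y i j f) = W (Inl i) * W_inv (Inl j) * W (Inr f)"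
| "gvar_image G (T f) = (\<Prod>i\<in>#ends G f. W (Inl i)) * W_inv (Inr f)"

definition toric_hom ::
  "('v, 'e) multigraph \<Rightarrow> ('v, 'e, 'k::field) gpoly \<Rightarrow> (('v + 'e \<Rightarrow>\<^sub>0 int) \<Rightarrow>\<^sub>0 'k)" where
  "toric_hom G = subst_hom (gvar_image G)"

definition toric_ideal :: "('v, 'e) multigraph \<Rightarrow> ('v, 'e, 'k::field) gpoly set" where
  "toric_ideal G = a_kernel (graph_ring G) (laurent_ring G) (toric_hom G)"

definition fundamental_binomials :: "('v, 'e) multigraph \<Rightarrow> ('v, 'e, 'k::field) gpoly set" where
  "fundamental_binomials G =
     (\<Union>{ {Var (Y i j f) * Var (Y j i f) - Var (ZE f) ^ 2,
           Var (Y i j f) * Var (T f) - Var (ZV i) ^ 2,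
           Var (Y j i f) * Var (T f) - Var (ZV j) ^ 2,
           Var (Y i j f) * Var (ZV j) - Var (ZV i) * Var (ZE f),
           Var (Y j i f) * Var (ZV i) - Var (ZV j) * Var (ZE f),
           Var (T f) * Var (ZE f) - Var (ZV i) * Var (ZV j)}
         | i j f. f \<in> edges G \<and> ends G f = {#i, j#}})"

definition zigzag_binomial ::
  "'v \<Rightarrow> 'v \<Rightarrow> ('v, 'e) dedge set \<Rightarrow> ('v, 'e) dedge set \<Rightarrow> ('v, 'e, 'k::field) gpoly" where
  "zigzag_binomial u v E\<^sub>1 E\<^sub>2 =
     Var (ZV v) * (\<Prod>(i, j, f)\<in>E\<^sub>1. Var (Y i j f)) * (\<Prod>(i, j, f)\<in>E\<^sub>2. Var (ZE f))
   - Var (ZV u) * (\<Prod>(i, j, f)\<in>E\<^sub>2. Var (Y i j f)) * (\<Prod>(i, j, f)\<in>E\<^sub>1. Var (ZE f))"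

definition cyclic_binomial ::
  "('v, 'e) dedge set \<Rightarrow> ('v, 'e) dedge set \<Rightarrow> ('v, 'e, 'k::field) gpoly" where
  "cyclic_binomial E\<^sub>1 E\<^sub>2 =
     (\<Prod>(i, j, f)\<in>E\<^sub>1. Var (Y i j f)) * (\<Prod>(i, j, f)\<in>E\<^sub>2. Var (ZE f))
   - (\<Prod>(i, j, f)\<in>E\<^sub>2. Var (Y i j f)) * (\<Prod>(i, j, f)\<in>E\<^sub>1. Var (ZE f))"


section \<open>Well-definedness\<close>

lemma carrier_ring_in:
  "carrier (ring_in A) = {p. \<forall>m\<in>Poly_Mapping.keys p. Poly_Mapping.keys m \<subseteq> A}"
  by (simp add: ring_in_def)

lemma ring_in_uminus:
  fixes p :: "('x \<Rightarrow>\<^sub>0 'n::comm_monoid_add) \<Rightarrow>\<^sub>0 'k::comm_ring_1"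
  assumes "p \<in> carrier (ring_in A)"
  shows "- p \<in> carrier (ring_in A)"
  using assms by (auto simp: carrier_ring_in in_keys_iff)

lemma ring_in_add:
  assumes "p \<in> carrier (ring_in A)" "q \<in> carrier (ring_in A)"
  shows "p + q \<in> carrier (ring_in A)"
  using assms Poly_Mapping.keys_add[of p q] unfolding carrier_ring_in by blast

lemma ring_in_mult:
  assumes "p \<in> carrier (ring_in A)" "q \<in> carrier (ring_in A)"
  shows "p * q \<in> carrier (ring_in A)"
  unfolding carrier_ring_in
proof (safe)
  fix m x assume m: "m \<in> Poly_Mapping.keys (p * q)" and x: "x \<in> Poly_Mapping.keys m"
  then obtain a b where ab: "a \<in> Poly_Mapping.keys p" "b \<in> Poly_Mapping.keys q" "m = a + b"
    using keys_mult[of p q] by blast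
  then have "x \<in> Poly_Mapping.keys a \<union> Poly_Mapping.keys b"
    using x Poly_Mapping.keys_add[of a b] by blast
  then show "x \<in> A"
    using assms ab unfolding carrier_ring_in by blast
qed

lemma cring_ring_in:
  "cring (ring_in A :: (('x \<Rightarrow>\<^sub>0 'n::comm_monoid_add) \<Rightarrow>\<^sub>0 'k::comm_ring_1) ring)"
    (is "cring ?R")
proof (rule cringI)
  show "abelian_group ?R"
  proof (rule abelian_groupI)
    fix x assume "x \<in> carrier ?R"
    then have "- x \<in> carrier ?R" "- x \<oplus>\<^bsub>?R\<^esub> x = \<zero>\<^bsub>?R\<^esub>"
      by (simp_all add: ring_in_uminus) (simp add: ring_in_def)
    then show "\<exists>y\<in>carrier ?R. y \<oplus>\<^bsub>?R\<^esub> x = \<zero>\<^bsub>?R\<^esub>" by blast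
  next
    fix x y assume "x \<in> carrier ?R" "y \<in> carrier ?R"
    then show "x \<oplus>\<^bsub>?R\<^esub> y \<in> carrier ?R"
      using ring_in_add[of x A y] by (simp add: ring_in_def)
  qed (simp_all add: ring_in_def ac_simps)
  show "comm_monoid ?R"
  proof (rule comm_monoidI)
    fix x y assume "x \<in> carrier ?R" "y \<in> carrier ?R"
    then show "x \<otimes>\<^bsub>?R\<^esub> y \<in> carrier ?R"
      using ring_in_mult[of x A y] by (simp add: ring_in_def)
  qed (simp_all add: ring_in_def ac_simps)
qed (simp add: ring_in_def algebra_simps)

lemma subst_hom_superset:
  assumes "finite S" "Poly_Mapping.keys p \<subseteq> S"
  shows "subst_hom g p =
    (\<Sum>m\<in>S. Poly_Mapping.single 0 (Poly_Mapping.lookup p m) *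
        (\<Prod>x\<in>Poly_Mapping.keys m. g x ^ Poly_Mapping.lookup m x))"
  unfolding subst_hom_def using assms
  by (intro sum.mono_neutral_left) (auto simp: in_keys_iff)

lemma subst_hom_add: "subst_hom g (p + q) = subst_hom g p + subst_hom g q"
proof -
  let ?S = "Poly_Mapping.keys p \<union> Poly_Mapping.keys q"
  have "Poly_Mapping.keys (p + q) \<subseteq> ?S" by (rule Poly_Mapping.keys_add)
  then show ?thesis
    by (simp add: subst_hom_superset[of ?S] lookup_add single_add distrib_right sum.distrib)
qed

lemma subst_hom_sum: "subst_hom g (sum h A) = (\<Sum>a\<in>A. subst_hom g (h a))"
  by (induction A rule: infinite_finite_induct)
     (simp_all add: subst_hom_add, simp_all add: subst_hom_def)

lemma subst_hom_single:
  "subst_hom g (Poly_Mapping.single m c) =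
     Poly_Mapping.single 0 c * (\<Prod>x\<in>Poly_Mapping.keys m. g x ^ Poly_Mapping.lookup m x)"
  by (subst subst_hom_superset[of "{m}"]) auto

lemma subst_monom_add:
  fixes g :: "'x \<Rightarrow> 'a::comm_monoid_mult"
  shows "(\<Prod>x\<in>Poly_Mapping.keys (m + n). g x ^ Poly_Mapping.lookup (m + n) x) =
         (\<Prod>x\<in>Poly_Mapping.keys m. g x ^ Poly_Mapping.lookup m x) * (\<Prod>x\<in>Poly_Mapping.keys n. g x ^ Poly_Mapping.lookup n x)"
proof -
  let ?S = "Poly_Mapping.keys m \<union> Poly_Mapping.keys n"
  have *: "(\<Prod>x\<in>Poly_Mapping.keys l. g x ^ Poly_Mapping.lookup l x) = (\<Prod>x\<in>?S. g x ^ Poly_Mapping.lookup l x)"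
    if "Poly_Mapping.keys l \<subseteq> ?S" for l :: "'x \<Rightarrow>\<^sub>0 nat"
    using that by (intro prod.mono_neutral_left) (auto simp: in_keys_iff)
  have "Poly_Mapping.keys (m + n) \<subseteq> ?S" by (rule Poly_Mapping.keys_add)
  then show ?thesis
    unfolding *[OF \<open>_ \<subseteq> ?S\<close>] *[of m, OF Un_upper1] *[of n, OF Un_upper2]
    by (simp add: lookup_add power_add prod.distrib)
qed

lemma poly_mapping_sum_single:
  "p = (\<Sum>m\<in>Poly_Mapping.keys p. Poly_Mapping.single m (Poly_Mapping.lookup p m))"
  by (rule poly_mapping_eqI)
     (auto simp: lookup_sum lookup_single when_def in_keys_iff sum.delta)

lemma single_0_mult:
  "(Poly_Mapping.single 0 (c * d) :: 'n::comm_monoid_add \<Rightarrow>\<^sub>0 'k::comm_ring_1) =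
     Poly_Mapping.single 0 c * Poly_Mapping.single 0 d"
  by (simp add: mult_single)

lemma subst_hom_mult: "subst_hom g (p * q) = subst_hom g p * subst_hom g q"
proof -
  let ?s = "\<lambda>p m. Poly_Mapping.single m (Poly_Mapping.lookup p m)"
  have "p * q = (\<Sum>m\<in>Poly_Mapping.keys p. \<Sum>n\<in>Poly_Mapping.keys q. ?s p m * ?s q n)"
    by (subst poly_mapping_sum_single[of p], subst poly_mapping_sum_single[of q])
       (simp add: sum_product)
  then have "subst_hom g (p * q) =
      (\<Sum>m\<in>Poly_Mapping.keys p. \<Sum>n\<in>Poly_Mapping.keys q. subst_hom g (?s p m * ?s q n))"
    by (simp add: subst_hom_sum)
  also have "\<dots> = (\<Sum>m\<in>Poly_Mapping.keys p. \<Sum>n\<in>Poly_Mapping.keys q. subst_hom g (?s p m) * subst_hom g (?s q n))"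
  proof (intro sum.cong refl)
    fix m n
    have "subst_hom g (?s p m * ?s q n) =
        Poly_Mapping.single 0 (Poly_Mapping.lookup p m) * Poly_Mapping.single 0 (Poly_Mapping.lookup q n) *
        ((\<Prod>x\<in>Poly_Mapping.keys m. g x ^ Poly_Mapping.lookup m x) *
         (\<Prod>x\<in>Poly_Mapping.keys n. g x ^ Poly_Mapping.lookup n x))"
      by (simp add: mult_single[of m] subst_hom_single subst_monom_add single_0_mult)
    then show "subst_hom g (?s p m * ?s q n) = subst_hom g (?s p m) * subst_hom g (?s q n)"
      by (simp only: subst_hom_single mult_ac)
  qed
  also have "\<dots> = subst_hom g p * subst_hom g q"
    unfolding subst_hom_single by (simp add: sum_product subst_hom_def)
  finally show ?thesis .
qed

lemma subst_hom_const: "subst_hom g (Poly_Mapping.single 0 c) = Poly_Mapping.single 0 c"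
  by (simp add: subst_hom_single)

lemma subst_hom_Var: "subst_hom g (Var x) = g x"
  by (simp add: Var_def subst_hom_single)

lemma W_inv_right: "W k * W_inv k = 1"
  by (simp add: W_def W_inv_def mult_single flip: single_add)

lemma ring_in_single:
  "Poly_Mapping.keys m \<subseteq> A \<Longrightarrow> Poly_Mapping.single m c \<in> carrier (ring_in A)"
  by (auto simp: carrier_ring_in)

lemma ring_in_power: "p \<in> carrier (ring_in A) \<Longrightarrow> p ^ n \<in> carrier (ring_in A)"
proof (induction n)
  case 0
  then show ?case by (simp add: carrier_ring_in)
next
  case (Suc n)
  then show ?case using ring_in_mult by fastforce
qed

lemma ring_in_prod:
  "(\<And>a. a \<in> S \<Longrightarrow> h a \<in> carrier (ring_in A)) \<Longrightarrow> prod h S \<in> carrier (ring_in A)"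
proof (induction S rule: infinite_finite_induct)
  case (insert a S)
  then show ?case by (simp add: ring_in_mult)
qed (simp_all add: carrier_ring_in)

lemma ring_in_sum:
  "(\<And>a. a \<in> S \<Longrightarrow> h a \<in> carrier (ring_in A)) \<Longrightarrow> sum h S \<in> carrier (ring_in A)"
proof (induction S rule: infinite_finite_induct)
  case (insert a S)
  then show ?case by (simp add: ring_in_add)
qed (simp_all add: carrier_ring_in)

lemma gvar_image_closed:
  assumes "is_graph G" "x \<in> gvars G"
  shows "(gvar_image G x :: ('v + 'e \<Rightarrow>\<^sub>0 int) \<Rightarrow>\<^sub>0 'k::field) \<in> carrier (laurent_ring G)"
proof -
  have W: "(W k :: ('v + 'e \<Rightarrow>\<^sub>0 int) \<Rightarrow>\<^sub>0 'k) \<in> carrier (laurent_ring G)"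
    "(W_inv k :: ('v + 'e \<Rightarrow>\<^sub>0 int) \<Rightarrow>\<^sub>0 'k) \<in> carrier (laurent_ring G)"
    if "k \<in> verts G <+> edges G" for k
    using that by (auto simp: W_def W_inv_def laurent_ring_def intro!: ring_in_single)
  have M: "(\<Prod>i\<in>#M. W (Inl i) :: ('v + 'e \<Rightarrow>\<^sub>0 int) \<Rightarrow>\<^sub>0 'k) \<in> carrier (laurent_ring G)"
    if "set_mset M \<subseteq> verts G" for M
    using that
  proof (induction M)
    case empty
    then show ?case by (simp add: laurent_ring_def carrier_ring_in)
  next
    case (add i M)
    then show ?case
      using W(1)[of "Inl i"] by (auto simp: laurent_ring_def intro!: ring_in_mult)
  qed
  have mult: "p * q \<in> carrier (laurent_ring G)"
    if "p \<in> carrier (laurent_ring G)" "q \<in> carrier (laurent_ring G)"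
    for p q :: "('v + 'e \<Rightarrow>\<^sub>0 int) \<Rightarrow>\<^sub>0 'k"
    using that by (simp add: laurent_ring_def ring_in_mult)
  have ends: "i \<in> verts G" "j \<in> verts G" if "f \<in> edges G" "ends G f = {#i, j#}" for i j f
    using assms(1) that unfolding is_graph_def by fastforce+
  show ?thesis
  proof (cases x)
    case (Y i j f)
    then have "f \<in> edges G" "ends G f = {#i, j#}"
      using assms(2) by (auto simp: gvars_def)
    then show ?thesis
      using Y ends[of f i j] by (auto intro!: W mult)
  next
    case (T f)
    then have "f \<in> edges G"
      using assms(2) by (auto simp: gvars_def)
    moreover from this have "set_mset (ends G f) \<subseteq> verts G"
      using assms(1) by (simp add: is_graph_def)
    ultimately show ?thesis
      using T by (auto intro!: W M mult)
  qed (use assms(2) in \<open>auto simp: gvars_def intro!: W\<close>)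
qed

lemma toric_hom_ring_hom:
  assumes "is_graph G"
  shows "(toric_hom G :: ('v, 'e, 'k::field) gpoly \<Rightarrow> _)
           \<in> ring_hom (graph_ring G) (laurent_ring G)"
proof (rule ring_hom_memI)
  fix p :: "('v, 'e, 'k) gpoly"
  assume p: "p \<in> carrier (graph_ring G)"
  have "Poly_Mapping.single 0 (Poly_Mapping.lookup p m) * (\<Prod>x\<in>Poly_Mapping.keys m. gvar_image G x ^ Poly_Mapping.lookup m x)
      \<in> carrier (ring_in (verts G <+> edges G))" if "m \<in> Poly_Mapping.keys p" for m
  proof (intro ring_in_mult ring_in_prod ring_in_power)
    fix x assume "x \<in> Poly_Mapping.keys m"
    then have "x \<in> gvars G"
      using p that by (auto simp: graph_ring_def carrier_ring_in)
    then show "(gvar_image G x :: ('v + 'e \<Rightarrow>\<^sub>0 int) \<Rightarrow>\<^sub>0 'k)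
        \<in> carrier (ring_in (verts G <+> edges G))"
      using gvar_image_closed[OF assms] by (simp add: laurent_ring_def)
  qed (simp add: ring_in_single)
  then show "toric_hom G p \<in> carrier (laurent_ring G)"
    by (simp add: toric_hom_def subst_hom_def laurent_ring_def ring_in_sum)
next
  show "toric_hom G \<one>\<^bsub>graph_ring G\<^esub> = (\<one>\<^bsub>laurent_ring G\<^esub> :: ('v + 'e \<Rightarrow>\<^sub>0 int) \<Rightarrow>\<^sub>0 'k)"
    using subst_hom_const[of "gvar_image G" "1 :: 'k"]
    by (simp add: toric_hom_def graph_ring_def laurent_ring_def ring_in_def)
qed (simp_all add: toric_hom_def graph_ring_def laurent_ring_def ring_in_def
        subst_hom_add subst_hom_mult)

end

theory Submission
  imports Defs
begin

text \<open>
  The toric ideal is spanned by differences of monomials of equal weight, so it suffices to connect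
  any two such monomials \<open>M\<close>, \<open>N\<close> by fundamental and cyclic binomials. The variables \<open>T f\<close> are
  removed first: either both monomials contain \<open>T f\<close> and it cancels, or one of them contains
  \<open>T f\<close> together with another variable of \<open>f\<close> and a fundamental binomial applies. A monomial
  without \<open>T\<close>-variables is an integer flow on the edges (\<open>Y i j f\<close> is a unit from \<open>i\<close> to \<open>j\<close>), with
  the exponents of the vertex variables as deficits. If these exponents differ at a vertex, shifting
  one unit along an edge brings the flows closer. Otherwise the difference of the flows is a
  circulation; it is zero or contains a directed cycle, along which a cyclic binomial brings the
  flows closer.
\<close>

section \<open>Monomials as multisets of variables\<close>

lemma sum_delta_both:
  "finite A \<Longrightarrow> (\<Sum>k\<in>A. if k = a \<and> P then c else 0) = (if a \<in> A \<and> P then c else (0::'a::comm_monoid_add))"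
  by (cases P) simp_all

lemma pair_subset_mset: "x \<in># M \<Longrightarrow> y \<in># M \<Longrightarrow> x \<noteq> y \<Longrightarrow> {#x, y#} \<subseteq># M"
  by (simp add: insert_subset_eq_iff in_diff_count)

text \<open>Multisets stand in for exponent vectors so that exchanging factors of a monomial becomes
  multiset subtraction and addition, with induction one variable at a time.\<close>

definition exps :: "'x multiset \<Rightarrow> ('x \<Rightarrow>\<^sub>0 nat)" where
  "exps M = (\<Sum>x\<in>#M. Poly_Mapping.single x 1)"

definition mset_monom :: "'x multiset \<Rightarrow> (('x \<Rightarrow>\<^sub>0 nat) \<Rightarrow>\<^sub>0 'k::comm_ring_1)" where
  "mset_monom M = Poly_Mapping.single (exps M) 1"

lemma lookup_exps: "Poly_Mapping.lookup (exps M) x = count M x"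
  unfolding exps_def by (induction M) (auto simp: lookup_add lookup_single when_def)

lemma keys_exps: "Poly_Mapping.keys (exps M) = set_mset M"
  by (auto simp: in_keys_iff lookup_exps)

lemma exps_surj: "\<exists>M. exps M = m"
proof
  show "exps (\<Sum>x\<in>Poly_Mapping.keys m. replicate_mset (Poly_Mapping.lookup m x) x) = m"
    by (rule poly_mapping_eqI) (auto simp: lookup_exps count_sum in_keys_iff if_distrib cong: if_cong)
qed

lemma mset_monom_empty [simp]: "mset_monom {#} = 1"
  by (simp add: mset_monom_def exps_def)

lemma mset_monom_plus: "mset_monom (M + N) = mset_monom M * mset_monom N"
  by (simp add: mset_monom_def exps_def mult_single)

lemma mset_monom_add_mset: "mset_monom (add_mset x M) = Var x * mset_monom M"
  by (simp add: mset_monom_def exps_def mult_single Var_def)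

lemma mset_monom_image_mset_set: "mset_monom (image_mset h (mset_set A)) = (\<Prod>a\<in>A. Var (h a))"
  by (induction A rule: infinite_finite_induct) (simp_all add: mset_monom_add_mset)

lemma mset_monom_closed_iff:
  "(mset_monom M :: ('x \<Rightarrow>\<^sub>0 nat) \<Rightarrow>\<^sub>0 'k::field) \<in> carrier (ring_in A) \<longleftrightarrow> set_mset M \<subseteq> A"
  by (auto simp: carrier_ring_in mset_monom_def keys_exps)

section \<open>Weights of monomials and binomials in the toric ideal\<close>

fun gvar_weight :: "('v, 'e) multigraph \<Rightarrow> ('v, 'e) gvar \<Rightarrow> ('v + 'e \<Rightarrow>\<^sub>0 int)" where
  "gvar_weight G (ZV i) = Poly_Mapping.single (Inl i) 1"
| "gvar_weight G (ZE f) = Poly_Mapping.single (Inr f) 1"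
| "gvar_weight G (Y i j f) = Poly_Mapping.single (Inl i) 1 - Poly_Mapping.single (Inl j) 1 + Poly_Mapping.single (Inr f) 1"
| "gvar_weight G (T f) = (\<Sum>i\<in>#ends G f. Poly_Mapping.single (Inl i) 1) - Poly_Mapping.single (Inr f) 1"

text \<open>The exponent vector of the Laurent monomial to which \<open>mset_monom M\<close> is
  mapped, so that the kernel condition on a binomial becomes an equality of weights.\<close>

definition weight :: "('v, 'e) multigraph \<Rightarrow> ('v, 'e) gvar multiset \<Rightarrow> ('v + 'e \<Rightarrow>\<^sub>0 int)" where
  "weight G M = (\<Sum>x\<in>#M. gvar_weight G x)"

lemma weight_simps [simp]:
  "weight G {#} = 0" "weight G (add_mset x M) = gvar_weight G x + weight G M"
  "weight G (M + N) = weight G M + weight G N"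
  by (simp_all add: weight_def)

lemma gvar_image_eq:
  fixes G :: "('v, 'e) multigraph"
  shows "(gvar_image G x :: ('v + 'e \<Rightarrow>\<^sub>0 int) \<Rightarrow>\<^sub>0 'k::field) = Poly_Mapping.single (gvar_weight G x) 1"
proof (cases x)
  case (T f)
  have "(\<Prod>i\<in>#M. W (Inl i) :: ('v + 'e \<Rightarrow>\<^sub>0 int) \<Rightarrow>\<^sub>0 'k) = Poly_Mapping.single (\<Sum>i\<in>#M. Poly_Mapping.single (Inl i) 1) 1" for M
    by (induction M) (simp_all add: W_def mult_single)
  then show ?thesis by (simp add: T W_inv_def mult_single single_uminus)
qed (simp_all add: W_def W_inv_def mult_single single_uminus)

lemma toric_hom_mset_monom: "toric_hom G (mset_monom M) = Poly_Mapping.single (weight G M) 1"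
proof (induction M)
  case empty
  show ?case using subst_hom_const[of "gvar_image G" 1] by (simp add: toric_hom_def)
next
  case (add x M)
  then show ?case
    by (simp add: mset_monom_add_mset toric_hom_def subst_hom_mult subst_hom_Var gvar_image_eq mult_single)
qed

lemma toric_ideal_iff:
  "p \<in> toric_ideal G \<longleftrightarrow> p \<in> carrier (graph_ring G) \<and> toric_hom G p = 0"
  by (auto simp: toric_ideal_def a_kernel_def' laurent_ring_def ring_in_def)

lemma toric_hom_diff: "toric_hom G (p - q) = toric_hom G p - toric_hom G q"
  using subst_hom_add[of "gvar_image G" "p - q" q] by (simp add: toric_hom_def)

lemma ring_in_minus:
  fixes p :: "('x \<Rightarrow>\<^sub>0 'n::comm_monoid_add) \<Rightarrow>\<^sub>0 'k::comm_ring_1"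
  assumes "p \<in> carrier (ring_in A)" "q \<in> carrier (ring_in A)"
  shows "p - q \<in> carrier (ring_in A)"
  using ring_in_add[OF assms(1) ring_in_uminus[OF assms(2)]] by simp

lemma binomial_in_toric_ideal:
  assumes "set_mset M \<subseteq> gvars G" "set_mset N \<subseteq> gvars G" "weight G M = weight G N"
  shows "(mset_monom M - mset_monom N :: ('v, 'e, 'k::field) gpoly) \<in> toric_ideal G"
  using assms
  by (simp add: toric_ideal_iff toric_hom_diff toric_hom_mset_monom graph_ring_def ring_in_minus mset_monom_closed_iff)

text \<open>Since \<open>1\<close> is nonzero in a field, a single term with coefficient
  \<open>1\<close> determines its exponent, here through its set of keys.\<close>

lemma weight_eq_of_binomial_in_toric_ideal:
  assumes "(mset_monom M - mset_monom N :: ('v, 'e, 'k::field) gpoly) \<in> toric_ideal G"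
  shows "weight G M = weight G N"
proof -
  have "Poly_Mapping.single (weight G M) (1::'k) = Poly_Mapping.single (weight G N) 1"
    using assms by (simp add: toric_ideal_iff toric_hom_diff toric_hom_mset_monom)
  then have "Poly_Mapping.keys (Poly_Mapping.single (weight G M) (1::'k)) = Poly_Mapping.keys (Poly_Mapping.single (weight G N) (1::'k))"
    by simp
  then show ?thesis by simp
qed

section \<open>The two monomials of cyclic and zig-zag binomials\<close>

definition flip :: "('v, 'e) dedge \<Rightarrow> ('v, 'e) dedge" where
  "flip = (\<lambda>(i, j, f). (j, i, f))"

text \<open>
  The factors of the two monomials of a cyclic binomial: \<open>S\<close> selects the edges of the first block.
\<close>

definition fwd :: "('v, 'e) dedge set \<Rightarrow> ('v, 'e) dedge \<Rightarrow> ('v, 'e) gvar" where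
  "fwd S = (\<lambda>(i, j, f). if (i, j, f) \<in> S then Y i j f else ZE f)"

definition bwd :: "('v, 'e) dedge set \<Rightarrow> ('v, 'e) dedge \<Rightarrow> ('v, 'e) gvar" where
  "bwd S = (\<lambda>(i, j, f). if (i, j, f) \<in> S then ZE f else Y j i f)"

lemma inj_flip: "inj_on flip A"
  by (auto simp: flip_def inj_on_def)

text \<open>The product over \<open>A\<close> splits into the edges inside and outside
  \<open>S\<close>. As \<open>flip\<close> is injective, the latter may be listed in reversed
  direction, as the second block of a pair does.\<close>

lemma mset_monom_fwd:
  assumes "finite A"
  shows "mset_monom (image_mset (fwd S) (mset_set A)) =
    (\<Prod>(i, j, f)\<in>A \<inter> S. Var (Y i j f)) * (\<Prod>(i, j, f)\<in>flip ` (A - S). Var (ZE f))"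
proof -
  have "(\<Prod>a\<in>A. Var (fwd S a)) = (\<Prod>a\<in>A \<inter> S. Var (fwd S a)) * (\<Prod>a\<in>A - S. Var (fwd S a))"
    by (rule prod.Int_Diff) fact
  also have "(\<Prod>a\<in>A \<inter> S. Var (fwd S a)) = (\<Prod>(i, j, f)\<in>A \<inter> S. Var (Y i j f))"
    by (rule prod.cong) (auto simp: fwd_def)
  also have "(\<Prod>a\<in>A - S. Var (fwd S a)) = (\<Prod>(i, j, f)\<in>flip ` (A - S). Var (ZE f))"
    by (subst prod.reindex[OF inj_flip]) (auto intro!: prod.cong simp: fwd_def flip_def)
  finally show ?thesis by (simp add: mset_monom_image_mset_set)
qed

lemma mset_monom_bwd:
  assumes "finite A"
  shows "mset_monom (image_mset (bwd S) (mset_set A)) =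
    (\<Prod>(i, j, f)\<in>flip ` (A - S). Var (Y i j f)) * (\<Prod>(i, j, f)\<in>A \<inter> S. Var (ZE f))"
proof -
  have "(\<Prod>a\<in>A. Var (bwd S a)) = (\<Prod>a\<in>A \<inter> S. Var (bwd S a)) * (\<Prod>a\<in>A - S. Var (bwd S a))"
    by (rule prod.Int_Diff) fact
  also have "(\<Prod>a\<in>A \<inter> S. Var (bwd S a)) = (\<Prod>(i, j, f)\<in>A \<inter> S. Var (ZE f))"
    by (rule prod.cong) (auto simp: bwd_def)
  also have "(\<Prod>a\<in>A - S. Var (bwd S a)) = (\<Prod>(i, j, f)\<in>flip ` (A - S). Var (Y i j f))"
    by (subst prod.reindex[OF inj_flip]) (auto intro!: prod.cong simp: bwd_def flip_def)
  finally show ?thesis by (simp add: mset_monom_image_mset_set mult.commute)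
qed

text \<open>With all edges of the cycle directed the same way in \<open>A\<close>, both monomials
  are products over one index set and can be compared edge by edge.\<close>

lemma cyclic_binomial_eq:
  "finite A \<Longrightarrow> cyclic_binomial (A \<inter> S) (flip ` (A - S)) =
     mset_monom (image_mset (fwd S) (mset_set A)) - mset_monom (image_mset (bwd S) (mset_set A))"
  by (simp add: cyclic_binomial_def mset_monom_fwd mset_monom_bwd)

lemma zigzag_binomial_eq:
  "finite A \<Longrightarrow> zigzag_binomial u v (A \<inter> S) (flip ` (A - S)) =
     mset_monom (add_mset (ZV v) (image_mset (fwd S) (mset_set A))) - mset_monom (add_mset (ZV u) (image_mset (bwd S) (mset_set A)))"
  by (simp add: zigzag_binomial_def mset_monom_fwd mset_monom_bwd mset_monom_add_mset mult.assoc)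

section \<open>Congruence of monomials modulo an ideal containing the fundamental binomials; zig-zag
  binomials\<close>

locale fundamental_ideal =
  fixes G :: "('v, 'e) multigraph" and I :: "('v, 'e, 'k::field) gpoly set"
  assumes graph: "is_graph G"
    and ideal: "ideal I (graph_ring G)"
    and fundamental: "fundamental_binomials G \<subseteq> I"
begin

text \<open>Congruence modulo \<open>I\<close>. The ideal is left arbitrary so that the same rules
  serve the ideal of the fundamental binomials alone and the larger one with the cyclic
  binomials.\<close>

definition rel :: "('v, 'e) gvar multiset \<Rightarrow> ('v, 'e) gvar multiset \<Rightarrow> bool" where
  "rel M N \<longleftrightarrow> (mset_monom M - mset_monom N :: ('v, 'e, 'k) gpoly) \<in> I"

lemma ends_verts: "f \<in> edges G \<Longrightarrow> ends G f = {#i, j#} \<Longrightarrow> i \<in> verts G \<and> j \<in> verts G"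
  using graph unfolding is_graph_def by fastforce

lemma ideal_zero: "0 \<in> I"
  using additive_subgroup.zero_closed[OF ideal.axioms(1)[OF ideal]] by (simp add: graph_ring_def ring_in_def)

lemma ideal_add: "p \<in> I \<Longrightarrow> q \<in> I \<Longrightarrow> p + q \<in> I"
  using additive_subgroup.a_closed[OF ideal.axioms(1)[OF ideal]] by (simp add: graph_ring_def ring_in_def)

lemma ideal_mult: "p \<in> carrier (graph_ring G) \<Longrightarrow> q \<in> I \<Longrightarrow> p * q \<in> I"
  using ideal.I_l_closed[OF ideal, of q p] by (simp add: graph_ring_def ring_in_def)

lemma ideal_uminus: "p \<in> I \<Longrightarrow> - p \<in> I"
  using ideal_mult[of "-1" p] ring_in_uminus[of 1 "gvars G"] by (simp add: graph_ring_def carrier_ring_in)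

lemma ideal_sum: "(\<And>a. a \<in> A \<Longrightarrow> h a \<in> I) \<Longrightarrow> sum h A \<in> I"
  by (induction A rule: infinite_finite_induct) (auto simp: ideal_zero ideal_add)

lemma rel_refl: "rel M M"
  by (simp add: rel_def ideal_zero)

lemma rel_sym: "rel M N \<Longrightarrow> rel N M"
  unfolding rel_def using ideal_uminus by fastforce

lemma rel_trans [trans]: "rel M N \<Longrightarrow> rel N K \<Longrightarrow> rel M K"
  unfolding rel_def using ideal_add[of "mset_monom M - mset_monom N" "mset_monom N - mset_monom K"] by simp

lemma rel_plus: "rel M N \<Longrightarrow> set_mset C \<subseteq> gvars G \<Longrightarrow> rel (C + M) (C + N)"
  unfolding rel_def mset_monom_plus right_diff_distrib[symmetric]
  by (rule ideal_mult) (simp_all add: graph_ring_def mset_monom_closed_iff)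

text \<open>\<open>M\<close> is \<open>L\<close> times the cofactor \<open>M - L\<close>;
  multiplying the relation by this cofactor rewrites a submonomial in place.\<close>

lemma rel_replace:
  assumes "rel L R" "L \<subseteq># M" "set_mset M \<subseteq> gvars G"
  shows "rel M (M - L + R)"
  using rel_plus[OF assms(1), of "M - L"] assms(2,3) by (auto dest: in_diffD)

lemma rel_fundamental:
  assumes "f \<in> edges G" "ends G f = {#i, j#}"
  shows "rel {#Y i j f, Y j i f#} {#ZE f, ZE f#}"
    and "rel {#T f, Y i j f#} {#ZV i, ZV i#}"
    and "rel {#T f, ZE f#} {#ZV i, ZV j#}"
    and "rel {#ZV j, Y i j f#} {#ZV i, ZE f#}"
    and "rel {#ZV j, ZE f#} {#ZV i, Y j i f#}"
proof -
  let ?F = "{Var (Y i j f) * Var (Y j i f) - Var (ZE f) ^ 2,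
           Var (Y i j f) * Var (T f) - Var (ZV i) ^ 2,
           Var (Y j i f) * Var (T f) - Var (ZV j) ^ 2,
           Var (Y i j f) * Var (ZV j) - Var (ZV i) * Var (ZE f),
           Var (Y j i f) * Var (ZV i) - Var (ZV j) * Var (ZE f),
           Var (T f) * Var (ZE f) - Var (ZV i) * Var (ZV j)} :: ('v, 'e, 'k) gpoly set"
  have "?F \<subseteq> fundamental_binomials G"
    unfolding fundamental_binomials_def by (rule Union_upper) (use assms in blast)
  with fundamental have F: "?F \<subseteq> I" by blast
  show "rel {#Y i j f, Y j i f#} {#ZE f, ZE f#}" "rel {#T f, Y i j f#} {#ZV i, ZV i#}"
    "rel {#T f, ZE f#} {#ZV i, ZV j#}" "rel {#ZV j, Y i j f#} {#ZV i, ZE f#}"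
    using F by (simp_all add: rel_def mset_monom_add_mset power2_eq_square mult.commute)
  have "rel {#ZV i, Y j i f#} {#ZV j, ZE f#}"
    using F by (simp add: rel_def mset_monom_add_mset mult.commute)
  then show "rel {#ZV j, ZE f#} {#ZV i, Y j i f#}" by (rule rel_sym)
qed

lemma fwd_bwd_gvars:
  assumes "f \<in> edges G" "ends G f = {#i, j#}"
  shows "fwd S (i, j, f) \<in> gvars G" "bwd S (i, j, f) \<in> gvars G"
proof -
  have "ends G f = {#j, i#}" using assms(2) by (simp add: add_mset_commute)
  then show "fwd S (i, j, f) \<in> gvars G" "bwd S (i, j, f) \<in> gvars G"
    using assms by (auto simp: fwd_def bwd_def gvars_def)
qed

text \<open>One fundamental binomial for each block: inside \<open>S\<close> the edge factor changes
  from \<open>Y i j f\<close> to \<open>ZE f\<close>, outside from \<open>ZE f\<close> to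
  \<open>Y j i f\<close>. Either way the vertex variable moves from the head \<open>j\<close> to the
  tail \<open>i\<close>.\<close>

lemma rel_shift:
  assumes "f \<in> edges G" "ends G f = {#i, j#}"
  shows "rel {#ZV j, fwd S (i, j, f)#} {#ZV i, bwd S (i, j, f)#}"
  using rel_fundamental(4,5)[OF assms] by (simp add: fwd_def bwd_def)

text \<open>Each edge of the path moves the vertex variable one step back towards \<open>u\<close>.\<close>

lemma zigzag_binomial_in_ideal:
  assumes "zigzag_pair G u v E\<^sub>1 E\<^sub>2"
  shows "zigzag_binomial u v E\<^sub>1 E\<^sub>2 \<in> I"
proof -
  obtain vs es P\<^sub>1 P\<^sub>2 where p: "is_path G vs es" "hd vs = u" "last vs = v"
    and P: "P\<^sub>1 \<union> P\<^sub>2 = set es" "P\<^sub>1 \<inter> P\<^sub>2 = {}"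
    and E1: "E\<^sub>1 = {(vs ! k, vs ! Suc k, es ! k) | k. k < length es \<and> es ! k \<in> P\<^sub>1}"
    and E2: "E\<^sub>2 = {(vs ! Suc k, vs ! k, es ! k) | k. k < length es \<and> es ! k \<in> P\<^sub>2}"
    using assms unfolding zigzag_pair_def by blast
  \<comment> \<open>Lying in the block \<open>P\<^sub>1\<close> depends on the edge alone; it is
    recast as a set of directed edges to fit \<open>fwd\<close> and \<open>bwd\<close>.\<close>
  define S where "S = {d :: ('v, 'e) dedge. snd (snd d) \<in> P\<^sub>1}"
  define t where "t = (\<lambda>k. (vs ! k, vs ! Suc k, es ! k))"
  have len: "length vs = Suc (length es)" and dist: "distinct vs"
    and edge: "\<And>k. k < length es \<Longrightarrow> es ! k \<in> edges G \<and> ends G (es ! k) = {#vs ! k, vs ! Suc k#}"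
    using p(1) by (auto simp: is_path_def)
  have P2: "es ! k \<in> P\<^sub>2 \<longleftrightarrow> es ! k \<notin> P\<^sub>1" if "k < length es" for k
    using P nth_mem[OF that] by blast
  \<comment> \<open>Invariant for the initial segment of \<open>n\<close> edges, with the vertex
    variable at position \<open>n\<close> on one side and at position 0 on the other; both sides
    agree for \<open>n = 0\<close>.\<close>
  have main: "rel (add_mset (ZV (vs ! n)) (image_mset (fwd S) (mset_set (t ` {..<n}))))
            (add_mset (ZV (vs ! 0)) (image_mset (bwd S) (mset_set (t ` {..<n}))))"
    if "n \<le> length es" for n
    using that
  proof (induction n)
    case 0
    show ?case by (simp add: rel_refl)
  next
    case (Suc n)
    let ?F = "image_mset (fwd S) (mset_set (t ` {..<n}))"
    let ?B = "image_mset (bwd S) (mset_set (t ` {..<n}))"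
    \<comment> \<open>The tails of the path edges are distinct vertices.\<close>
    have "t n \<notin> t ` {..<n}"
      using Suc.prems dist by (auto simp: t_def len nth_eq_iff_index_eq)
    then have ins: "mset_set (t ` {..<Suc n}) = add_mset (t n) (mset_set (t ` {..<n}))"
      by (simp add: lessThan_Suc)
    have Fg: "set_mset ?F \<subseteq> gvars G"
    proof -
      have "fwd S (t k) \<in> gvars G" if "k < n" for k
        using edge[of k] Suc.prems that fwd_bwd_gvars(1)[of "es ! k" "vs ! k" "vs ! Suc k" S]
        by (simp add: t_def)
      then show ?thesis by auto
    qed
    have e: "es ! n \<in> edges G" "ends G (es ! n) = {#vs ! n, vs ! Suc n#}"
      using edge[of n] Suc.prems by auto
    \<comment> \<open>First the shift along edge \<open>n\<close>, with the earlier
      \<open>fwd\<close> factors as context; then the induction hypothesis, with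
      \<open>bwd S (t n)\<close> as context.\<close>
    have "rel (?F + {#ZV (vs ! Suc n), fwd S (t n)#}) (?F + {#ZV (vs ! n), bwd S (t n)#})"
      unfolding t_def by (intro rel_plus rel_shift e Fg[unfolded t_def])
    also have "?F + {#ZV (vs ! n), bwd S (t n)#} = {#bwd S (t n)#} + add_mset (ZV (vs ! n)) ?F"
      by simp
    also have "rel \<dots> ({#bwd S (t n)#} + add_mset (ZV (vs ! 0)) ?B)"
      using Suc fwd_bwd_gvars(2)[OF e, of S] by (intro rel_plus) (auto simp: t_def)
    finally show ?case
      unfolding ins by (simp add: add_mset_commute)
  qed
  have "vs \<noteq> []" using len by auto
  then have uv: "u = vs ! 0" "v = vs ! length es"
    using p len by (auto simp: hd_conv_nth last_conv_nth)
  have S: "t k \<in> S \<longleftrightarrow> es ! k \<in> P\<^sub>1" for k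
    by (simp add: t_def S_def)
  have "E\<^sub>1 = t ` {k. k < length es \<and> es ! k \<in> P\<^sub>1}"
    unfolding E1 t_def by (rule setcompr_eq_image)
  also have "\<dots> = t ` {..<length es} \<inter> S"
    using S by blast
  finally have E1_eq: "E\<^sub>1 = t ` {..<length es} \<inter> S" .
  have "E\<^sub>2 = (\<lambda>k. flip (t k)) ` {k. k < length es \<and> es ! k \<in> P\<^sub>2}"
    unfolding E2 t_def flip_def prod.case by (rule setcompr_eq_image)
  then have E2_eq: "E\<^sub>2 = flip ` (t ` {..<length es} - S)"
    using S P2 by blast
  show ?thesis
    unfolding uv E1_eq E2_eq zigzag_binomial_eq[OF finite_imageI[OF finite_lessThan]]
    using main[of "length es"] by (simp only: rel_def order.refl)
qed

end


text \<open>The cycle is an orbit segment of minimal period.\<close>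

lemma obtain_cycle:
  assumes "finite X" "v \<in> X" "\<And>x. x \<in> X \<Longrightarrow> s x \<in> X"
  obtains vs where "vs \<noteq> []" "distinct vs" "set vs \<subseteq> X"
    "\<forall>k<length vs. vs ! (Suc k mod length vs) = s (vs ! k)"
proof -
  define x where "x = (\<lambda>k. (s ^^ k) v)"
  have x: "x k \<in> X" for k
    by (induction k) (auto simp: x_def assms)
  have Suc: "x (Suc k) = s (x k)" for k
    by (simp add: x_def)
  have "\<not> inj x"
    using finite_subset[OF _ assms(1), of "range x"] x finite_imageD[of x UNIV] by auto
  then obtain a b where "x a = x b" "a < b"
    unfolding inj_def by (metis linorder_neqE_nat)
  then have ex: "\<exists>p>0. \<exists>i. x (i + p) = x i"
    by (intro exI[of _ "b - a"]) (auto intro!: exI[of _ a])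
  \<comment> \<open>The period is minimized over all starting indices, so no shorter repetition
    occurs anywhere in the orbit and the \<open>p\<close> values from \<open>x i\<close> on are
    distinct.\<close>
  define p where "p = (LEAST p. 0 < p \<and> (\<exists>i. x (i + p) = x i))"
  obtain i where p: "0 < p" "x (i + p) = x i"
    using LeastI_ex[OF ex, folded p_def] by blast
  have least: "x (j + q) \<noteq> x j" if "0 < q" "q < p" for j q
    using not_less_Least[of q "\<lambda>p. 0 < p \<and> (\<exists>i. x (i + p) = x i)"] that by (auto simp: p_def)
  define vs where "vs = map (\<lambda>k. x (i + k)) [0..<p]"
  show thesis
  proof
    show "vs \<noteq> []" using p by (simp add: vs_def)
    have "x (i + a) \<noteq> x (i + b)" if "a < b" "b < p" for a b
      using least[of "b - a" "i + a"] that by (simp add: less_imp_diff_less)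
    then show "distinct vs"
      unfolding vs_def distinct_map by (auto simp: inj_on_def) (metis linorder_neqE_nat)
    show "set vs \<subseteq> X" using x by (auto simp: vs_def)
    have "vs ! (Suc k mod length vs) = s (vs ! k)" if "k < length vs" for k
    proof (cases "Suc k = p")
      case True
      \<comment> \<open>At the last position the orbit closes up, because
        \<open>x (i + p) = x i\<close>.\<close>
      with p that Suc[of "i + k"] show ?thesis by (simp add: vs_def) (metis add_Suc_right)
    next
      case False
      with that Suc[of "i + k"] show ?thesis by (simp add: vs_def)
    qed
    then show "\<forall>k<length vs. vs ! (Suc k mod length vs) = s (vs ! k)" by blast
  qed
qed

section \<open>Monomials without \<open>T\<close>-variables\<close>

definition T_free :: "('v, 'e) multigraph \<Rightarrow> ('v, 'e) gvar multiset \<Rightarrow> bool" where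
  "T_free G M \<longleftrightarrow> set_mset M \<subseteq> gvars G \<and> (\<forall>f. T f \<notin># M)"

text \<open>Net flow, antisymmetric in the endpoints and zero on loops: replacing
  \<open>Y i j f\<close> and \<open>Y j i f\<close> by two copies of \<open>ZE f\<close> leaves it
  unchanged.\<close>

definition flow :: "('v, 'e) gvar multiset \<Rightarrow> 'v \<Rightarrow> 'v \<Rightarrow> 'e \<Rightarrow> int" where
  "flow M i j f = int (count M (Y i j f)) - int (count M (Y j i f))"

definition excess :: "('v, 'e) gvar multiset \<Rightarrow> ('v, 'e) gvar multiset \<Rightarrow> 'v \<Rightarrow> 'v \<Rightarrow> 'e \<Rightarrow> int" where
  "excess M N i j f = flow M i j f - flow N i j f"

text \<open>The termination measure. For \<open>T_free\<close> monomials an edge with nonzero excess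
  is counted once in each direction.\<close>

definition distance :: "('v, 'e) multigraph \<Rightarrow> ('v, 'e) gvar multiset \<Rightarrow> ('v, 'e) gvar multiset \<Rightarrow> nat" where
  "distance G M N = (\<Sum>(i, j, f)\<in>verts G \<times> verts G \<times> edges G. nat \<bar>excess M N i j f\<bar>)"

lemma flow_plus: "flow (M + N) i j f = flow M i j f + flow N i j f"
  by (simp add: flow_def)

lemma flow_simps: "flow {#} i j f = 0" "flow (add_mset (ZE g) M) i j f = flow M i j f"
  by (simp_all add: flow_def)

lemma flow_minus: "N \<subseteq># M \<Longrightarrow> flow (M - N) i j f = flow M i j f - flow N i j f"
  using flow_plus[of "M - N" N i j f] by simp

lemma flow_add_mset_Y:
  "flow (add_mset (Y i j f) M) v k g = flow M v k g
     + of_bool (v = i \<and> k = j \<and> g = f) - of_bool (v = j \<and> k = i \<and> g = f)"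
proof -
  have "int (count (add_mset (Y i j f) M) (Y a b g)) = int (count M (Y a b g)) + of_bool (a = i \<and> b = j \<and> g = f)" for a b
    by (cases "Y a b g = Y i j f") (simp_all add: count_add_mset)
  then show ?thesis by (simp add: flow_def conj_ac)
qed

lemma excess_swap: "excess M N j i f = - excess M N i j f"
  by (simp add: excess_def flow_def)

lemma distance_commute: "distance G M N = distance G N M"
  unfolding distance_def by (rule sum.cong) (auto simp: excess_def)

lemma T_free_induct [consumes 1, case_names empty ZV ZE Y]:
  assumes "T_free G M" "P {#}"
    and "\<And>v M. v \<in> verts G \<Longrightarrow> P M \<Longrightarrow> P (add_mset (ZV v) M)"
    and "\<And>f M. f \<in> edges G \<Longrightarrow> P M \<Longrightarrow> P (add_mset (ZE f) M)"
    and "\<And>i j f M. f \<in> edges G \<Longrightarrow> ends G f = {#i, j#} \<Longrightarrow> P M \<Longrightarrow> P (add_mset (Y i j f) M)"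
  shows "P M"
  using assms(1)
proof (induction M)
  case (add x M)
  then have "P M" "x \<in> gvars G" "\<nexists>f. x = T f" by (auto simp: T_free_def)
  then show ?case using assms(3-5) by (auto simp: gvars_def)
qed (rule assms(2))

text \<open>A factor \<open>Y i j f\<close> adds 1 at \<open>i\<close> and subtracts 1 at
  \<open>j\<close>, exactly its contribution to the outflow of these vertices; on a loop the two
  cancel.\<close>

lemma weight_vertex:
  assumes "T_free G M" "is_graph G"
  shows "Poly_Mapping.lookup (weight G M) (Inl v) =
    int (count M (ZV v)) + (\<Sum>(j, f)\<in>verts G \<times> edges G. flow M v j f)"
  using assms(1)
proof (induction rule: T_free_induct)
  case (Y i j f M)
  have fin: "finite (verts G)" "finite (edges G)" and ij: "i \<in> verts G" "j \<in> verts G"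
    using assms(2) Y(1,2) unfolding is_graph_def by fastforce+
  \<comment> \<open>The new unit of flow is written as two indicator sums, each supported on a
    single pair.\<close>
  have "(\<Sum>(k, g)\<in>verts G \<times> edges G. flow (add_mset (Y i j f) M) v k g) =
    (\<Sum>(k, g)\<in>verts G \<times> edges G. flow M v k g)
    + (\<Sum>a\<in>verts G \<times> edges G. (if a = (j, f) \<and> v = i then 1 else 0))
    - (\<Sum>a\<in>verts G \<times> edges G. (if a = (i, f) \<and> v = j then 1 else 0))"
    unfolding sum.distrib[symmetric] sum_subtractf[symmetric]
    by (rule sum.cong) (simp_all add: flow_add_mset_Y case_prod_unfold prod_eq_iff conj_ac of_bool_def)
  then show ?case
    using Y fin ij by (simp add: lookup_add lookup_minus lookup_single when_def sum_delta_both)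
qed (simp_all add: lookup_add lookup_single flow_def)

text \<open>A loop has only one \<open>Y\<close>-variable, which must not be counted twice; hence
  the case distinction.\<close>

lemma weight_edge:
  assumes "T_free G M" "ends G f = {#i, j#}"
  shows "Poly_Mapping.lookup (weight G M) (Inr f) =
    int (count M (ZE f)) + int (count M (Y i j f)) + (if i = j then 0 else int (count M (Y j i f)))"
  using assms(1)
proof (induction rule: T_free_induct)
  case (Y k l g M)
  have "g = f \<Longrightarrow> (k = i \<and> l = j) \<or> (k = j \<and> l = i)"
    using Y(2) assms(2) by (auto simp: add_eq_conv_ex)
  then show ?case using Y(3) by (auto simp: lookup_add lookup_minus lookup_single when_def)
qed (simp_all add: lookup_add lookup_single when_def)

text \<open>Nonzero excess requires a \<open>Y\<close>-variable of \<open>f\<close> between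
  \<open>i\<close> and \<open>j\<close> in one of the monomials, and on a loop every flow is
  zero.\<close>

lemma excess_edge:
  assumes "T_free G M" "T_free G N" "excess M N i j f \<noteq> 0"
  shows "f \<in> edges G" "ends G f = {#i, j#}" "i \<noteq> j"
proof -
  have "Y i j f \<in># M \<or> Y j i f \<in># M \<or> Y i j f \<in># N \<or> Y j i f \<in># N"
    by (rule ccontr) (use assms(3) in \<open>simp add: excess_def flow_def not_in_iff\<close>)
  then have "Y i j f \<in> gvars G \<or> Y j i f \<in> gvars G"
    using assms(1,2) unfolding T_free_def by blast
  then show "f \<in> edges G" "ends G f = {#i, j#}"
    by (auto simp: gvars_def add_mset_commute)
  show "i \<noteq> j" using assms(3) by (auto simp: excess_def flow_def)
qed

text \<open>Equal weights fix the joint exponent of \<open>ZE f\<close> and the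
  \<open>Y\<close>-variables of \<open>f\<close>. Were both factors missing, all of it would sit on
  \<open>Y j i f\<close>, making the flow of \<open>M\<close> from \<open>i\<close> to
  \<open>j\<close> as small as possible.\<close>

lemma excess_pos_available:
  assumes "T_free G M" "T_free G N" "weight G M = weight G N" "excess M N i j f > 0"
  shows "Y i j f \<in># M \<or> ZE f \<in># M"
proof (rule ccontr)
  assume "\<not> ?thesis"
  then have "count M (Y i j f) = 0" "count M (ZE f) = 0"
    by (auto simp: not_in_iff)
  moreover have "ends G f = {#i, j#}" "i \<noteq> j"
    using excess_edge(2,3)[OF assms(1,2), of i j f] assms(4) by auto
  ultimately show False
    using weight_edge[OF assms(1), of f i j] weight_edge[OF assms(2), of f i j] assms(3,4)
    by (auto simp: excess_def flow_def)
qed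

section \<open>Exchanging \<open>fwd\<close> for \<open>bwd\<close> and its effect on the
  distance\<close>

lemma flow_fwd:
  assumes "finite A"
  shows "flow (image_mset (fwd S) (mset_set A)) i j f = of_bool ((i, j, f) \<in> A \<inter> S) - of_bool ((j, i, f) \<in> A \<inter> S)"
  using assms
proof (induction A)
  case (insert a A)
  obtain k l g where a: "a = (k, l, g)" by (cases a)
  have mem: "of_bool (x \<in> insert a A \<inter> S) = (of_bool (x = a \<and> a \<in> S) + of_bool (x \<in> A \<inter> S) :: int)" for x
    by (cases "x = a") (use insert.hyps in auto)
  have "flow (add_mset (fwd S a) M) i j f = flow M i j f + of_bool ((i, j, f) = a \<and> a \<in> S) - of_bool ((j, i, f) = a \<and> a \<in> S)" for M
    by (cases "a \<in> S") (simp_all add: a fwd_def flow_add_mset_Y flow_simps conj_ac)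
  then show ?case
    using insert unfolding mem by simp
qed (simp add: flow_def)

lemma flow_bwd:
  assumes "finite A"
  shows "flow (image_mset (bwd S) (mset_set A)) i j f = of_bool ((j, i, f) \<in> A - S) - of_bool ((i, j, f) \<in> A - S)"
  using assms
proof (induction A)
  case (insert a A)
  obtain k l g where a: "a = (k, l, g)" by (cases a)
  have mem: "of_bool (x \<in> insert a A - S) = (of_bool (x = a \<and> a \<notin> S) + of_bool (x \<in> A - S) :: int)" for x
    by (cases "x = a") (use insert.hyps in auto)
  have "flow (add_mset (bwd S a) M) i j f = flow M i j f + of_bool ((j, i, f) = a \<and> a \<notin> S) - of_bool ((i, j, f) = a \<and> a \<notin> S)" for M
    by (cases "a \<in> S") (simp_all add: a bwd_def flow_add_mset_Y flow_simps conj_ac)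
  then show ?case
    using insert unfolding mem by simp
qed (simp add: flow_def)

text \<open>The endpoints agree up to order, and antisymmetry of the excess rules out the reversed
  order.\<close>

lemma excess_pos_inj:
  assumes "T_free G M" "T_free G N" "excess M N i j f > 0" "excess M N k l f > 0"
  shows "i = k \<and> j = l"
proof -
  have "{#i, j#} = {#k, l#}"
    using excess_edge(2)[OF assms(1,2), of i j f] excess_edge(2)[OF assms(1,2), of k l f] assms(3,4) by auto
  then have "(i = k \<and> j = l) \<or> (i = l \<and> j = k)" by (auto simp: add_eq_conv_ex)
  then show ?thesis using assms(3,4) excess_swap[of M N i j f] by auto
qed

text \<open>\<open>S\<close> selects for each edge a factor that \<open>M\<close> contains: the
  \<open>Y\<close>-variable if it occurs, and otherwise \<open>ZE f\<close>. Different elements of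
  \<open>A\<close> use different edges, so their factors are distinct and divide \<open>M\<close>
  jointly.\<close>

lemma fwd_subset:
  assumes "T_free G M" "T_free G N" "weight G M = weight G N" "finite A"
    and pos: "\<And>i j f. (i, j, f) \<in> A \<Longrightarrow> excess M N i j f > 0"
    and S: "S = {(i, j, f) |i j f. Y i j f \<in># M}"
  shows "image_mset (fwd S) (mset_set A) \<subseteq># M"
proof -
  have "inj_on (fwd S) A"
    using excess_pos_inj[OF assms(1,2)] by (force simp: inj_on_def fwd_def dest: pos split: if_splits)
  moreover have "fwd S ` A \<subseteq> set_mset M"
  proof (rule image_subsetI)
    fix a assume "a \<in> A"
    moreover obtain i j f where "a = (i, j, f)" by (cases a)
    ultimately show "fwd S a \<in> set_mset M"
      using excess_pos_available[OF assms(1-3) pos, of i j f] by (auto simp: fwd_def S)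
  qed
  ultimately show ?thesis
    using assms(4) by (auto simp: image_mset_mset_set subseteq_mset_def count_mset_set' Suc_le_eq)
qed

text \<open>The exchange lowers the flow by one along every edge of \<open>A\<close>: edges in
  \<open>S\<close> lose a forward unit, the others gain a backward one. As the excess is positive
  there, its absolute value drops.\<close>

lemma distance_decreases:
  assumes "is_graph G" "T_free G M" "T_free G N" "finite A" "A \<noteq> {}"
    and pos: "\<And>i j f. (i, j, f) \<in> A \<Longrightarrow> excess M N i j f > 0"
    and flow: "\<And>i j f. flow M' i j f = flow M i j f - flow (image_mset (fwd S) (mset_set A)) i j f + flow (image_mset (bwd S) (mset_set A)) i j f"
  shows "distance G M' N < distance G M N"
  unfolding distance_def
proof (rule sum_strict_mono_ex1)
  have ex: "excess M' N i j f = excess M N i j f - of_bool ((i, j, f) \<in> A) + of_bool ((j, i, f) \<in> A)" for i j f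
    by (auto simp: excess_def flow flow_fwd flow_bwd assms(4))
  \<comment> \<open>By antisymmetry \<open>A\<close> never contains both directions of an edge, so
    at most one of the two corrections applies.\<close>
  have le: "nat \<bar>excess M' N i j f\<bar> \<le> nat \<bar>excess M N i j f\<bar>" for i j f
    using pos[of i j f] pos[of j i f] excess_swap[of M N i j f] unfolding ex by (auto simp: of_bool_def)
  then show "\<forall>x\<in>verts G \<times> verts G \<times> edges G.
      (case x of (i, j, f) \<Rightarrow> nat \<bar>excess M' N i j f\<bar>) \<le> (case x of (i, j, f) \<Rightarrow> nat \<bar>excess M N i j f\<bar>)"
    by auto
  obtain i j f where A: "(i, j, f) \<in> A" using assms(5) by auto
  have e: "excess M N i j f > 0" using pos A by auto
  then have f: "f \<in> edges G" "ends G f = {#i, j#}"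
    using excess_edge[OF assms(2,3), of i j f] by auto
  then have "i \<in> verts G" "j \<in> verts G"
    using assms(1) unfolding is_graph_def by fastforce+
  moreover have "(j, i, f) \<notin> A" using pos[of j i f] e excess_swap[of M N i j f] by auto
  then have "nat \<bar>excess M' N i j f\<bar> < nat \<bar>excess M N i j f\<bar>" using A e by (simp add: ex)
  ultimately show "\<exists>x\<in>verts G \<times> verts G \<times> edges G.
      (case x of (i, j, f) \<Rightarrow> nat \<bar>excess M' N i j f\<bar>) < (case x of (i, j, f) \<Rightarrow> nat \<bar>excess M N i j f\<bar>)"
    using f by (intro bexI[of _ "(i, j, f)"]) auto
qed (use assms(1) in \<open>simp add: is_graph_def\<close>)

lemma T_free_replace: "T_free G M \<Longrightarrow> T_free G R \<Longrightarrow> T_free G (M - L + R)"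
  unfolding T_free_def by (auto dest: in_diffD)

lemma T_free_bwd:
  assumes "finite A" "\<And>i j f. (i, j, f) \<in> A \<Longrightarrow> f \<in> edges G \<and> ends G f = {#i, j#}"
  shows "T_free G (image_mset (bwd S) (mset_set A))"
proof -
  have "bwd S a \<in> gvars G \<and> (\<forall>f. bwd S a \<noteq> T f)" if "a \<in> A" for a
  proof (cases a)
    case (fields i j f)
    with assms(2) that have "f \<in> edges G" "ends G f = {#j, i#}" by (auto simp: add_mset_commute)
    with fields show ?thesis by (auto simp: bwd_def gvars_def)
  qed
  then show ?thesis using assms(1) by (simp add: T_free_def image_subset_iff) (metis imageE)
qed

section \<open>Reduced monomials\<close>

lemma obtain_ends:
  assumes "is_graph G" "f \<in> edges G"
  obtains i j where "ends G f = {#i, j#}"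
proof -
  have "size (ends G f) = Suc 1" using assms by (simp add: is_graph_def)
  then obtain i N where "ends G f = add_mset i N" "size N = 1"
    using size_eq_Suc_imp_eq_union by fastforce
  then show thesis using that size_1_singleton_mset by metis
qed

text \<open>Normal form under cancelling opposite \<open>Y\<close>-variables. The case
  \<open>i = j\<close> excludes the \<open>Y\<close>-variables of loops altogether.\<close>

definition reduced :: "('v, 'e) gvar multiset \<Rightarrow> bool" where
  "reduced M \<longleftrightarrow> (\<forall>i j f. \<not> (Y i j f \<in># M \<and> Y j i f \<in># M))"

text \<open>Of two opposite \<open>Y\<close>-variables at most one occurs, so the flow determines
  all their exponents; the weight then determines those of the vertex and edge variables.\<close>

lemma reduced_eqI:
  assumes "is_graph G" "T_free G M" "T_free G N" "reduced M" "reduced N" "weight G M = weight G N"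
    and flow: "\<And>i j f. flow M i j f = flow N i j f"
  shows "M = N"
proof (rule multiset_eqI)
  have Y: "count M (Y i j f) = count N (Y i j f)" for i j f
  proof -
    have "count M (Y i j f) = 0 \<or> count M (Y j i f) = 0" "count N (Y i j f) = 0 \<or> count N (Y j i f) = 0"
      using assms(4,5) unfolding reduced_def by (auto simp: not_in_iff)
    then show ?thesis using flow[of i j f] by (auto simp: flow_def)
  qed
  show "count M x = count N x" for x
  proof (cases x)
    case (ZV v)
    then show ?thesis
      using weight_vertex[OF assms(2,1), of v] weight_vertex[OF assms(3,1), of v] assms(6) by (simp add: flow)
  next
    case (ZE f)
    show ?thesis
    proof (cases "f \<in> edges G")
      case True
      then obtain i j where "ends G f = {#i, j#}" by (rule obtain_ends[OF assms(1)])
      then show ?thesis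
        using weight_edge[OF assms(2), of f i j] weight_edge[OF assms(3), of f i j] assms(6) ZE
        by (cases "i = j") (simp_all add: Y)
    next
      case False
      then have "ZE f \<notin> gvars G" by (auto simp: gvars_def)
      then have "ZE f \<notin># M" "ZE f \<notin># N" using assms(2,3) by (auto simp: T_free_def)
      then show ?thesis using ZE by (simp add: not_in_iff)
    qed
  next
    case (T f)
    then show ?thesis using assms(2,3) by (simp add: T_free_def not_in_iff)
  qed (simp add: Y)
qed

section \<open>The edge coordinate of the weight in the presence of
  \<open>T\<close>-variables\<close>

lemma lookup_sum_Inl_Inr: "Poly_Mapping.lookup (\<Sum>i\<in>#K. Poly_Mapping.single (Inl i) c) (Inr f) = 0"
  by (induction K) (simp_all add: lookup_add lookup_single)

text \<open>Among all variables only \<open>T f\<close> has a negative exponent at the edge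
  \<open>f\<close>. Together with the next lemma this yields a partner for \<open>T f\<close> when
  the other monomial of equal weight lacks it.\<close>

lemma weight_edge_without_partner:
  assumes "ZE f \<notin># M" "\<And>i j. Y i j f \<notin># M"
  shows "Poly_Mapping.lookup (weight G M) (Inr f) = - int (count M (T f))"
  using assms
proof (induction M)
  case (add x M)
  then show ?case
    by (cases x) (auto simp: lookup_add lookup_minus lookup_single when_def lookup_sum_Inl_Inr)
qed simp

lemma weight_edge_without_T:
  assumes "T f \<notin># M"
  shows "Poly_Mapping.lookup (weight G M) (Inr f) \<ge> 0"
  using assms
proof (induction M)
  case (add x M)
  then show ?case
    by (cases x) (auto simp: lookup_add lookup_minus lookup_single when_def lookup_sum_Inl_Inr)
qed simp

section \<open>Connecting monomials of equal weight\<close>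

text \<open>The assumption \<open>toric\<close> makes rewriting preserve the weight, so that
  induction hypotheses apply to rewritten monomials.\<close>

locale cyclic_ideal = fundamental_ideal G I
  for G :: "('v, 'e) multigraph" and I :: "('v, 'e, 'k::field) gpoly set" +
  assumes cyclic: "\<And>E\<^sub>1 E\<^sub>2. cyclic_pair G E\<^sub>1 E\<^sub>2 \<Longrightarrow> cyclic_binomial E\<^sub>1 E\<^sub>2 \<in> I"
    and toric: "I \<subseteq> toric_ideal G"
begin

lemma rel_weight: "rel M N \<Longrightarrow> weight G M = weight G N"
  unfolding rel_def using toric by (blast intro: weight_eq_of_binomial_in_toric_ideal)

text \<open>A loop is a cycle of length one, and this is its cyclic binomial.\<close>

lemma rel_loop:
  assumes "f \<in> edges G" "ends G f = {#i, i#}"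
  shows "rel {#Y i i f#} {#ZE f#}"
proof -
  have "is_cycle G [i] [f]"
    using assms ends_verts[OF assms] by (simp add: is_cycle_def)
  then have "cyclic_pair G {(i, i, f)} {}"
    unfolding cyclic_pair_def
    by (intro exI[of _ "[i]"] exI[of _ "[f]"] exI[of _ "{f}"] exI[of _ "{}"]) auto
  from cyclic[OF this] show ?thesis
    by (simp add: rel_def cyclic_binomial_def mset_monom_add_mset)
qed

text \<open>With equal weights, a larger exponent at \<open>v\<close> means a smaller net outflow
  from \<open>v\<close>. Hence some edge into \<open>v\<close> has positive excess, and
  \<open>ZV v\<close> is shifted back along it.\<close>

lemma step_vertex:
  assumes M: "T_free G M" and N: "T_free G N" and w: "weight G M = weight G N"
    and v: "count N (ZV v) < count M (ZV v)"
  obtains M' where "rel M M'" "T_free G M'" "distance G M' N < distance G M N"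
proof -
  obtain j f where "excess M N v j f < 0"
  proof -
    have "\<exists>j f. excess M N v j f < 0"
    proof (rule ccontr)
      assume "\<not> ?thesis"
      then have "(\<Sum>(j, f)\<in>verts G \<times> edges G. flow N v j f) \<le> (\<Sum>(j, f)\<in>verts G \<times> edges G. flow M v j f)"
        by (intro sum_mono) (auto simp: excess_def not_less)
      then show False
        using weight_vertex[OF M graph, of v] weight_vertex[OF N graph, of v] w v by simp
    qed
    with that show thesis by blast
  qed
  then have ex: "excess M N j v f > 0"
    using excess_swap[of M N j v f] by simp
  then have f: "f \<in> edges G" "ends G f = {#j, v#}"
    using excess_edge[OF M N, of j v f] by auto
  define S where "S = {(i, j, f) |i j f. Y i j f \<in># M}"
  let ?A = "{(j, v, f)}"
  have sub: "image_mset (fwd S) (mset_set ?A) \<subseteq># M"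
    by (rule fwd_subset[OF M N w]) (use ex S_def in auto)
  define L where "L = {#ZV v, fwd S (j, v, f)#}"
  define R where "R = {#ZV j, bwd S (j, v, f)#}"
  have "fwd S (j, v, f) \<noteq> ZV v" by (simp add: fwd_def)
  moreover have "ZV v \<in># M" using v by (simp flip: count_greater_zero_iff)
  ultimately have L: "L \<subseteq># M"
    using sub by (simp add: L_def pair_subset_mset)
  show thesis
  proof
    show "rel M (M - L + R)"
      using rel_shift[OF f, of S] L M by (intro rel_replace) (auto simp: L_def R_def T_free_def)
    have "T_free G (image_mset (bwd S) (mset_set ?A))"
      by (rule T_free_bwd) (use f in auto)
    moreover have "ZV j \<in> gvars G" using ends_verts[OF f] by (simp add: gvars_def)
    ultimately have "T_free G R" by (auto simp: R_def T_free_def)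
    then show "T_free G (M - L + R)" by (rule T_free_replace[OF M])
    show "distance G (M - L + R) N < distance G M N"
    proof (rule distance_decreases[OF graph M N, of ?A])
      show "flow (M - L + R) a b c = flow M a b c - flow (image_mset (fwd S) (mset_set ?A)) a b c
          + flow (image_mset (bwd S) (mset_set ?A)) a b c" for a b c
        unfolding flow_plus flow_minus[OF L] by (simp add: L_def R_def flow_def)
    qed (use ex in auto)
  qed
qed

text \<open>Equal vertex exponents make the excess a circulation. Following edges of positive excess
  never gets stuck and closes a directed cycle, whose cyclic binomial rewrites
  \<open>M\<close>.\<close>

lemma step_cycle:
  assumes M: "T_free G M" and N: "T_free G N" and w: "weight G M = weight G N"
    and v: "\<And>v. count M (ZV v) = count N (ZV v)" and pos: "excess M N a b g > 0"
  obtains M' where "rel M M'" "T_free G M'" "distance G M' N < distance G M N"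
proof -
  define X where "X = {v. \<exists>j f. excess M N v j f > 0}"
  have edge: "f \<in> edges G" "ends G f = {#i, j#}" "i \<in> verts G" "j \<in> verts G"
    if "excess M N i j f > 0" for i j f
    using excess_edge[OF M N, of i j f] that ends_verts[of f i j] by auto
  have "X \<subseteq> verts G" using edge by (auto simp: X_def)
  then have "finite X" using graph finite_subset by (auto simp: is_graph_def)
  have "\<forall>v\<in>X. \<exists>j f. excess M N v j f > 0" by (simp add: X_def)
  then obtain s e where se: "\<And>v. v \<in> X \<Longrightarrow> excess M N v (s v) (e v) > 0"
    by metis
  \<comment> \<open>Conservation at \<open>s v\<close>: the edge from \<open>v\<close> contributes a
    negative term to a vanishing sum, so a positive term must occur as well.\<close>
  have sX: "s v \<in> X" if "v \<in> X" for v
  proof (rule ccontr)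
    let ?D = "\<lambda>(j, f). excess M N (s v) j f"
    assume "s v \<notin> X"
    then have le: "excess M N (s v) j f \<le> 0" for j f by (force simp: X_def not_less)
    have "(\<Sum>x\<in>verts G \<times> edges G. ?D x) < (\<Sum>x\<in>verts G \<times> edges G. 0)"
    proof (rule sum_strict_mono_ex1)
      show "\<exists>x\<in>verts G \<times> edges G. ?D x < 0"
        using edge[OF se[OF that]] se[OF that] excess_swap[of M N "s v" v "e v"]
        by (intro bexI[of _ "(v, e v)"]) auto
    qed (use graph le in \<open>auto simp: is_graph_def\<close>)
    moreover have "(\<Sum>x\<in>verts G \<times> edges G. ?D x) = 0"
      using weight_vertex[OF M graph, of "s v"] weight_vertex[OF N graph, of "s v"] w v[of "s v"]
      by (simp add: excess_def case_prod_unfold sum_subtractf)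
    ultimately show False by simp
  qed
  have "a \<in> X" using pos by (auto simp: X_def)
  obtain vs where vs: "vs \<noteq> []" "distinct vs" "set vs \<subseteq> X"
    and nxt': "\<forall>k<length vs. vs ! (Suc k mod length vs) = s (vs ! k)"
    by (rule obtain_cycle[OF \<open>finite X\<close> \<open>a \<in> X\<close> sX])
  note nxt = nxt'[rule_format]
  define es where "es = map e vs"
  define t where "t = (\<lambda>v. (v, s v, e v))"
  define A where "A = t ` set vs"
  define S where "S = {(i, j, f) |i j f. Y i j f \<in># M}"
  \<comment> \<open>An edge has only one direction of positive excess and hence determines its tail;
    in particular a cycle of length two does not run back along the same edge.\<close>
  have inj: "inj_on e (set vs)"
  proof (rule inj_onI)
    fix x y assume "x \<in> set vs" "y \<in> set vs" "e x = e y"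
    then show "x = y"
      using excess_pos_inj[OF M N, of x "s x" "e x" y "s y"] se[of x] se[of y] vs(3) by auto
  qed
  have A: "finite A" "A \<noteq> {}" using vs by (auto simp: A_def)
  have posA: "excess M N i j f > 0" if "(i, j, f) \<in> A" for i j f
    using that se vs(3) by (auto simp: A_def t_def)
  have "is_cycle G vs es"
    unfolding is_cycle_def
  proof (intro conjI allI impI)
    show "distinct es" using vs(2) inj by (simp add: es_def distinct_map)
    show "set vs \<subseteq> verts G" using vs(3) \<open>X \<subseteq> verts G\<close> by blast
    show "set es \<subseteq> edges G" using edge(1)[OF se] vs(3) by (auto simp: es_def)
    show "ends G (es ! k) = {#vs ! k, vs ! (Suc k mod length vs)#}" if "k < length es" for k
    proof -
      have "k < length vs" using that by (simp add: es_def)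
      moreover from this have "vs ! k \<in> X" using vs(3) by auto
      ultimately show ?thesis using edge(2)[OF se] by (simp add: nxt es_def)
    qed
  qed (use vs in \<open>auto simp: es_def\<close>)
  moreover
  \<comment> \<open>The first block consists of the cycle edges whose forward
    \<open>Y\<close>-variable occurs in \<open>M\<close>; on the others \<open>M\<close> offers
    \<open>ZE f\<close>.\<close>
  define C\<^sub>1 where "C\<^sub>1 = e ` {v \<in> set vs. t v \<in> S}"
  define C\<^sub>2 where "C\<^sub>2 = e ` {v \<in> set vs. t v \<notin> S}"
  have "C\<^sub>1 \<union> C\<^sub>2 = set es" by (auto simp: C\<^sub>1_def C\<^sub>2_def es_def)
  moreover have "C\<^sub>1 \<inter> C\<^sub>2 = {}" using inj by (auto simp: C\<^sub>1_def C\<^sub>2_def inj_on_def)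
  moreover
  have C: "es ! k \<in> C\<^sub>1 \<longleftrightarrow> t (vs ! k) \<in> S" "es ! k \<in> C\<^sub>2 \<longleftrightarrow> t (vs ! k) \<notin> S" if "k < length es" for k
  proof -
    have k: "k < length vs" "es ! k = e (vs ! k)" using that by (simp_all add: es_def)
    then have "vs ! k \<in> set vs" by simp
    then show "es ! k \<in> C\<^sub>1 \<longleftrightarrow> t (vs ! k) \<in> S" "es ! k \<in> C\<^sub>2 \<longleftrightarrow> t (vs ! k) \<notin> S"
      unfolding C\<^sub>1_def C\<^sub>2_def k(2) using inj by (auto simp: inj_on_def)
  qed
  have tk: "(vs ! k, vs ! (Suc k mod length vs), es ! k) = t (vs ! k)"
    "(vs ! (Suc k mod length vs), vs ! k, es ! k) = flip (t (vs ! k))" if "k < length es" for k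
    using that by (simp_all add: t_def es_def nxt flip_def)
  have img: "(\<lambda>k. h (vs ! k)) ` {k. k < length es \<and> P (vs ! k)} = h ` {v \<in> set vs. P v}" for h :: "'v \<Rightarrow> ('v, 'e) dedge" and P
    by (auto simp: es_def in_set_conv_nth)
  have "A \<inter> S = {(vs ! k, vs ! (Suc k mod length vs), es ! k) | k. k < length es \<and> es ! k \<in> C\<^sub>1}"
  proof -
    have "{(vs ! k, vs ! (Suc k mod length vs), es ! k) | k. k < length es \<and> es ! k \<in> C\<^sub>1}
        = (\<lambda>k. (vs ! k, vs ! (Suc k mod length vs), es ! k)) ` {k. k < length es \<and> es ! k \<in> C\<^sub>1}"
      by (rule setcompr_eq_image)
    also have "\<dots> = (\<lambda>k. t (vs ! k)) ` {k. k < length es \<and> t (vs ! k) \<in> S}"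
      by (rule image_cong) (simp_all add: C tk cong: conj_cong)
    also have "\<dots> = A \<inter> S" unfolding img[of t "\<lambda>v. t v \<in> S"] A_def by blast
    finally show ?thesis by simp
  qed
  moreover have "flip ` (A - S) = {(vs ! (Suc k mod length vs), vs ! k, es ! k) | k. k < length es \<and> es ! k \<in> C\<^sub>2}"
  proof -
    have "{(vs ! (Suc k mod length vs), vs ! k, es ! k) | k. k < length es \<and> es ! k \<in> C\<^sub>2}
        = (\<lambda>k. (vs ! (Suc k mod length vs), vs ! k, es ! k)) ` {k. k < length es \<and> es ! k \<in> C\<^sub>2}"
      by (rule setcompr_eq_image)
    also have "\<dots> = (\<lambda>k. flip (t (vs ! k))) ` {k. k < length es \<and> t (vs ! k) \<notin> S}"
      by (rule image_cong) (simp_all add: C tk cong: conj_cong)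
    also have "\<dots> = flip ` (A - S)" unfolding img[of "\<lambda>v. flip (t v)" "\<lambda>v. t v \<notin> S"] A_def by blast
    finally show ?thesis by simp
  qed
  ultimately have "cyclic_pair G (A \<inter> S) (flip ` (A - S))"
    unfolding cyclic_pair_def by blast
  from cyclic[OF this]
  have rel: "rel (image_mset (fwd S) (mset_set A)) (image_mset (bwd S) (mset_set A))"
    by (simp only: rel_def cyclic_binomial_eq[OF A(1)])
  have sub: "image_mset (fwd S) (mset_set A) \<subseteq># M"
    by (rule fwd_subset[OF M N w A(1) posA S_def])
  let ?M' = "M - image_mset (fwd S) (mset_set A) + image_mset (bwd S) (mset_set A)"
  show thesis
  proof
    show "rel M ?M'"
      by (rule rel_replace[OF rel sub]) (use M in \<open>simp add: T_free_def\<close>)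
    show "T_free G ?M'"
      by (intro T_free_replace M T_free_bwd A(1)) (use posA edge in blast)
    show "distance G ?M' N < distance G M N"
      by (rule distance_decreases[OF graph M N A posA]) (simp_all add: flow_plus flow_minus[OF sub])
  qed
qed

text \<open>Opposite \<open>Y\<close>-variables become two copies of \<open>ZE f\<close>, and the
  \<open>Y\<close>-variable of a loop becomes one. The degree need not fall, so the induction counts
  the factors other than edge variables.\<close>

lemma reduce:
  assumes "T_free G M"
  shows "\<exists>N. rel M N \<and> T_free G N \<and> reduced N \<and> (\<forall>i j f. flow N i j f = flow M i j f)"
  using assms
proof (induction "size (filter_mset (\<lambda>x. \<forall>f. x \<noteq> ZE f) M)" arbitrary: M rule: less_induct)
  case less
  show ?case
  proof (cases "reduced M")
    case True
    with less.prems rel_refl show ?thesis by blast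
  next
    case False
    then obtain i j f where Y: "Y i j f \<in># M" "Y j i f \<in># M" by (auto simp: reduced_def)
    then have "Y i j f \<in> gvars G" using less.prems by (auto simp: T_free_def)
    then have f: "f \<in> edges G" "ends G f = {#i, j#}" by (auto simp: gvars_def)
    define L where "L = (if i = j then {#Y i j f#} else {#Y i j f, Y j i f#})"
    define R where "R = (if i = j then {#ZE f#} else {#ZE f, ZE f#} :: ('v, 'e) gvar multiset)"
    have L: "L \<subseteq># M" using Y by (auto simp: L_def intro: pair_subset_mset)
    have "rel L R"
      using rel_loop[of f i] rel_fundamental(1)[OF f] f by (auto simp: L_def R_def)
    then have rel: "rel M (M - L + R)"
      using L less.prems by (intro rel_replace) (simp_all add: T_free_def)
    have "T_free G R" using f by (auto simp: R_def T_free_def gvars_def)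
    then have T: "T_free G (M - L + R)" by (rule T_free_replace[OF less.prems])
    have flow: "flow (M - L + R) a b c = flow M a b c" for a b c
      unfolding flow_plus flow_minus[OF L] by (simp add: L_def R_def flow_simps flow_add_mset_Y)
    let ?F = "filter_mset (\<lambda>x. \<forall>f. x \<noteq> ZE f) :: ('v, 'e) gvar multiset \<Rightarrow> _"
    have F: "?F L = L" "?F R = {#}" "L \<noteq> {#}" by (simp_all add: L_def R_def)
    have "L \<subseteq># ?F M" using multiset_filter_mono[OF L, of "\<lambda>x. \<forall>f. x \<noteq> ZE f"] by (simp only: F)
    moreover have "?F (M - L + R) = ?F M - L"
      by (simp only: filter_union_mset filter_diff_mset F add_0_right)
    ultimately have "size (?F (M - L + R)) < size (?F M)"
      using F(3) size_mset_mono[of L "?F M"] by (simp add: size_Diff_submset flip: size_eq_0_iff_empty)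
    from less.hyps[OF this T] obtain N where "rel (M - L + R) N" "T_free G N" "reduced N"
      "\<forall>a b c. flow N a b c = flow M a b c" unfolding flow by blast
    with rel_trans[OF rel] show ?thesis by blast
  qed
qed

lemma rel_T_free:
  assumes "T_free G M" "T_free G N" "weight G M = weight G N"
  shows "rel M N"
  using assms
proof (induction "distance G M N" arbitrary: M N rule: less_induct)
  case (less M N)
  note M = less.prems(1) and N = less.prems(2) and w = less.prems(3)
  show ?case
  proof (cases "\<exists>v. count M (ZV v) \<noteq> count N (ZV v)")
    case True
    then obtain v where "count N (ZV v) < count M (ZV v) \<or> count M (ZV v) < count N (ZV v)"
      by (auto simp: neq_iff)
    then show ?thesis
    proof
      assume "count N (ZV v) < count M (ZV v)"
      then obtain M' where M': "rel M M'" "T_free G M'" "distance G M' N < distance G M N"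
        by (rule step_vertex[OF M N w])
      have "rel M' N"
        using less.hyps[OF M'(3,2) N] rel_weight[OF M'(1)] w by simp
      with M'(1) show ?thesis by (rule rel_trans)
    next
      assume "count M (ZV v) < count N (ZV v)"
      then obtain N' where N': "rel N N'" "T_free G N'" "distance G N' M < distance G N M"
        by (rule step_vertex[OF N M w[symmetric]])
      have "rel N' M"
        using less.hyps[OF _ N'(2) M] N'(3) rel_weight[OF N'(1)] w by (simp add: distance_commute)
      with N'(1) have "rel N M" by (rule rel_trans)
      then show ?thesis by (rule rel_sym)
    qed
  next
    case False
    then have v: "count M (ZV v) = count N (ZV v)" for v by blast
    show ?thesis
    proof (cases "\<exists>i j f. excess M N i j f > 0")
      case True
      then obtain i j f where "excess M N i j f > 0" by blast
      then obtain M' where M': "rel M M'" "T_free G M'" "distance G M' N < distance G M N"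
        by (rule step_cycle[OF M N w v])
      have "rel M' N"
        using less.hyps[OF M'(3,2) N] rel_weight[OF M'(1)] w by simp
      with M'(1) show ?thesis by (rule rel_trans)
    next
      case False
      \<comment> \<open>By antisymmetry the absence of positive excess forces equal flows, so the
        reduced forms of both monomials coincide.\<close>
      then have le: "excess M N i j f \<le> 0" for i j f by (force simp: not_less)
      have flow: "flow M i j f = flow N i j f" for i j f
        using le[of i j f] le[of j i f] excess_swap[of M N i j f] by (simp add: excess_def)
      obtain M' where M': "rel M M'" "T_free G M'" "reduced M'" "\<And>i j f. flow M' i j f = flow M i j f"
        using reduce[OF M] by blast
      obtain N' where N': "rel N N'" "T_free G N'" "reduced N'" "\<And>i j f. flow N' i j f = flow N i j f"
        using reduce[OF N] by blast
      have "M' = N'"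
        by (rule reduced_eqI[OF graph M'(2) N'(2) M'(3) N'(3)])
           (use rel_weight[OF M'(1)] rel_weight[OF N'(1)] w M'(4) N'(4) flow in auto)
      with M'(1) rel_sym[OF N'(1)] show ?thesis by (auto intro: rel_trans)
    qed
  qed
qed

lemma rel_if_weight_eq:
  assumes "set_mset M \<subseteq> gvars G" "set_mset N \<subseteq> gvars G" "weight G M = weight G N"
  shows "rel M N"
proof -
  \<comment> \<open>\<open>T\<close>-variables count twice: trading \<open>T f\<close> and a partner
    for two vertex variables keeps the degree but lowers \<tau>.\<close>
  define \<tau> :: "('v, 'e) gvar multiset \<Rightarrow> nat" where
    "\<tau> M = size M + size (filter_mset (\<lambda>x. \<exists>f. x = T f) M)" for M
  have \<tau>_plus: "\<tau> (K + L) = \<tau> K + \<tau> L" for K L by (simp add: \<tau>_def)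
  show ?thesis using assms
  proof (induction "\<tau> M + \<tau> N" arbitrary: M N rule: less_induct)
    case (less M N)
    \<comment> \<open>Stated for any pair with the same total measure, so that it applies to
      \<open>M\<close> and \<open>N\<close> in either order.\<close>
    have eliminate: "rel K L" if T: "T f \<in># K"
      and K: "set_mset K \<subseteq> gvars G" and L: "set_mset L \<subseteq> gvars G"
      and w: "weight G K = weight G L" and \<tau>: "\<tau> K + \<tau> L = \<tau> M + \<tau> N" for K L f
    proof (cases "T f \<in># L")
      case True
      obtain K' L' where K': "K = {#T f#} + K'" and L': "L = {#T f#} + L'"
        using T True by (metis mset_add add_mset_add_single union_commute)
      have "rel K' L'"
        by (rule less.hyps) (use \<tau> K L w in \<open>simp_all add: K' L' \<tau>_plus, simp add: \<tau>_def\<close>)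
      then show ?thesis
        unfolding K' L' by (rule rel_plus) (use K K' in auto)
    next
      case False
      \<comment> \<open>\<open>L\<close> has a nonnegative exponent at \<open>f\<close>, so a factor
        of \<open>K\<close> must compensate for the negative one of \<open>T f\<close>.\<close>
      have "\<exists>x\<in>#K. x = ZE f \<or> (\<exists>i j. x = Y i j f)"
      proof (rule ccontr)
        assume "\<not> ?thesis"
        then have "Poly_Mapping.lookup (weight G K) (Inr f) = - int (count K (T f))"
          by (intro weight_edge_without_partner) auto
        moreover have "count K (T f) > 0" using T by simp
        ultimately show False
          using weight_edge_without_T[OF False, of G] w by simp
      qed
      then obtain x where x: "x \<in># K" "x = ZE f \<or> (\<exists>i j. x = Y i j f)" by blast
      have "f \<in> edges G" using T K by (auto simp: gvars_def)
      have "\<exists>i j. rel {#T f, x#} {#ZV i, ZV j#} \<and> i \<in> verts G \<and> j \<in> verts G"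
        using x(2)
      proof
        assume "x = ZE f"
        obtain i j where ij: "ends G f = {#i, j#}" by (rule obtain_ends[OF graph \<open>f \<in> edges G\<close>])
        show ?thesis
          using rel_fundamental(3)[OF \<open>f \<in> edges G\<close> ij] ends_verts[OF \<open>f \<in> edges G\<close> ij] \<open>x = ZE f\<close> by blast
      next
        assume "\<exists>i j. x = Y i j f"
        then obtain i j where "x = Y i j f" by blast
        moreover from this have ij: "ends G f = {#i, j#}" using x(1) K by (auto simp: gvars_def)
        ultimately show ?thesis
          using rel_fundamental(2)[OF \<open>f \<in> edges G\<close> ij] ends_verts[OF \<open>f \<in> edges G\<close> ij] by blast
      qed
      then obtain i j where rel: "rel {#T f, x#} {#ZV i, ZV j#}" and ij: "i \<in> verts G" "j \<in> verts G"
        by blast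
      have "{#T f, x#} \<subseteq># K" using T x by (intro pair_subset_mset) auto
      then obtain K' where K': "K = {#T f, x#} + K'" by (auto simp: mset_subset_eq_exists_conv)
      have "set_mset K' \<subseteq> gvars G" using K K' by auto
      from rel_plus[OF rel this] have 1: "rel K ({#ZV i, ZV j#} + K')"
        by (simp add: K' union_commute)
      also have "rel ({#ZV i, ZV j#} + K') L"
      proof (rule less.hyps)
        show "\<tau> ({#ZV i, ZV j#} + K') + \<tau> L < \<tau> M + \<tau> N"
          using \<tau> unfolding K' \<tau>_plus by (simp add: \<tau>_def)
        show "set_mset ({#ZV i, ZV j#} + K') \<subseteq> gvars G"
          using ij \<open>set_mset K' \<subseteq> gvars G\<close> by (auto simp: gvars_def)
        show "weight G ({#ZV i, ZV j#} + K') = weight G L"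
          using rel_weight[OF 1] w by simp
      qed (rule L)
      finally show ?thesis .
    qed
    show ?case
    proof (cases "\<exists>f. T f \<in># M \<or> T f \<in># N")
      case True
      then obtain f where "T f \<in># M \<or> T f \<in># N" by blast
      then show ?thesis
      proof
        assume "T f \<in># M"
        then show ?thesis using less.prems by (rule eliminate) simp
      next
        assume "T f \<in># N"
        then have "rel N M"
          using less.prems(2,1) less.prems(3)[symmetric] by (rule eliminate) simp
        then show ?thesis by (rule rel_sym)
      qed
    next
      case False
      then show ?thesis using less.prems by (intro rel_T_free) (auto simp: T_free_def)
    qed
  qed
qed

text \<open>Terms of \<open>p\<close> are grouped by weight. The coefficients in each group sum to
  zero, so replacing every monomial by a fixed representative of its weight gives zero; subtracting
  this writes \<open>p\<close> through binomials of equal weight.\<close>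

lemma toric_ideal_subset: "toric_ideal G \<subseteq> I"
proof
  fix p :: "('v, 'e, 'k) gpoly" assume p: "p \<in> toric_ideal G"
  define c where "c = Poly_Mapping.lookup p"
  define K where "K = Poly_Mapping.keys p"
  define ms :: "(('v, 'e) gvar \<Rightarrow>\<^sub>0 nat) \<Rightarrow> ('v, 'e) gvar multiset" where "ms m = (SOME M. exps M = m)" for m
  define w where "w m = weight G (ms m)" for m
  \<comment> \<open>The chosen representative of weight \<open>a\<close>, taken among the monomials
    of \<open>p\<close> so that it stays in the ring of the graph.\<close>
  define r where "r a = ms (SOME m. m \<in> K \<and> w m = a)" for a
  have ms: "exps (ms m) = m" for m
    unfolding ms_def by (rule someI_ex) (rule exps_surj)
  have r: "r (w m) \<in> ms ` K \<and> weight G (r (w m)) = w m" if "m \<in> K" for m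
    using someI[of "\<lambda>m'. m' \<in> K \<and> w m' = w m" m] that by (simp add: r_def w_def)
  have gv: "set_mset (ms m) \<subseteq> gvars G" if "m \<in> K" for m
    using p that keys_exps[of "ms m"]
    by (auto simp: K_def toric_ideal_iff graph_ring_def carrier_ring_in ms)
  have fin: "finite K" by (simp add: K_def)
  let ?s = "\<lambda>a. Poly_Mapping.single 0 a :: ('v, 'e, 'k) gpoly"
  have p_sum: "p = (\<Sum>m\<in>K. ?s (c m) * mset_monom (ms m))"
    unfolding K_def c_def mset_monom_def by (simp add: ms mult_single flip: poly_mapping_sum_single)
  have "0 = toric_hom G p" using p by (simp add: toric_ideal_iff)
  also have "\<dots> = (\<Sum>m\<in>K. Poly_Mapping.single (w m) (c m))"
    unfolding p_sum toric_hom_def subst_hom_sum subst_hom_mult subst_hom_const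
    unfolding toric_hom_def[symmetric] toric_hom_mset_monom by (simp add: mult_single w_def)
  \<comment> \<open>Comparison of the coefficients of the Laurent monomial with exponent
    \<open>a\<close>.\<close>
  finally have coeff: "(\<Sum>m\<in>K. c m when w m = a) = 0" for a
    by (metis (no_types, lifting) lookup_sum lookup_single lookup_zero sum.cong)
  have "(\<Sum>m\<in>K. ?s (c m) * mset_monom (r (w m))) = (\<Sum>a\<in>w ` K. \<Sum>m\<in>{m \<in> K. w m = a}. ?s (c m) * mset_monom (r (w m)))"
    by (rule sum.image_gen[OF fin])
  also have "\<dots> = (\<Sum>a\<in>w ` K. ?s (\<Sum>m\<in>K. c m when w m = a) * mset_monom (r a))"
  proof (rule sum.cong[OF refl])
    fix a
    have "(\<Sum>m\<in>K. c m when w m = a) = (\<Sum>m\<in>{m \<in> K. w m = a}. c m)"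
      using fin by (simp add: when_def sum.inter_filter)
    moreover have "?s (sum c B) = (\<Sum>m\<in>B. ?s (c m))" for B
      by (induction B rule: infinite_finite_induct) (simp_all add: single_add)
    ultimately show "(\<Sum>m\<in>{m \<in> K. w m = a}. ?s (c m) * mset_monom (r (w m))) = ?s (\<Sum>m\<in>K. c m when w m = a) * mset_monom (r a)"
      by (simp add: sum_distrib_right)
  qed
  also have "\<dots> = 0" by (simp add: coeff)
  finally have "p = (\<Sum>m\<in>K. ?s (c m) * (mset_monom (ms m) - mset_monom (r (w m))))"
    by (subst p_sum) (simp add: right_diff_distrib sum_subtractf)
  also have "\<dots> \<in> I"
  proof (intro ideal_sum ideal_mult)
    fix m assume m: "m \<in> K"
    show "?s (c m) \<in> carrier (graph_ring G)" by (simp add: graph_ring_def ring_in_single)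
    obtain m' where "m' \<in> K" "r (w m) = ms m'" using r[OF m] by blast
    then have "set_mset (r (w m)) \<subseteq> gvars G" by (simp add: gv)
    then have "rel (ms m) (r (w m))"
      using r[OF m] gv[OF m] by (intro rel_if_weight_eq) (auto simp: w_def)
    then show "mset_monom (ms m) - mset_monom (r (w m)) \<in> I" by (simp add: rel_def)
  qed
  finally show "p \<in> I" .
qed

end

section \<open>Generators of the toric ideal\<close>

lemma toric_ideal_ideal:
  assumes "is_graph G"
  shows "ideal (toric_ideal G :: ('v, 'e, 'k::field) gpoly set) (graph_ring G)"
proof -
  have "ring_hom_ring (graph_ring G) (laurent_ring G) (toric_hom G :: ('v, 'e, 'k) gpoly \<Rightarrow> _)"
    using toric_hom_ring_hom[OF assms]
    by (intro ring_hom_ringI2) (auto simp: graph_ring_def laurent_ring_def intro: cring.axioms(1)[OF cring_ring_in])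
  then show ?thesis
    unfolding toric_ideal_def by (rule ring_hom_ring.kernel_is_ideal)
qed

lemma fundamental_binomials_toric:
  assumes "is_graph G"
  shows "(fundamental_binomials G :: ('v, 'e, 'k::field) gpoly set) \<subseteq> toric_ideal G"
proof
  fix p :: "('v, 'e, 'k) gpoly" assume "p \<in> fundamental_binomials G"
  then obtain i j f where f: "f \<in> edges G" "ends G f = {#i, j#}"
    and p: "p \<in> {Var (Y i j f) * Var (Y j i f) - Var (ZE f) ^ 2,
           Var (Y i j f) * Var (T f) - Var (ZV i) ^ 2,
           Var (Y j i f) * Var (T f) - Var (ZV j) ^ 2,
           Var (Y i j f) * Var (ZV j) - Var (ZV i) * Var (ZE f),
           Var (Y j i f) * Var (ZV i) - Var (ZV j) * Var (ZE f),
           Var (T f) * Var (ZE f) - Var (ZV i) * Var (ZV j)}"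
    unfolding fundamental_binomials_def by blast
  have "i \<in> verts G" "j \<in> verts G" using assms f unfolding is_graph_def by fastforce+
  moreover have "Y j i f \<in> gvars G" using f by (auto simp: gvars_def add_mset_commute)
  ultimately have gv: "ZV i \<in> gvars G" "ZV j \<in> gvars G" "ZE f \<in> gvars G" "T f \<in> gvars G"
    "Y i j f \<in> gvars G" "Y j i f \<in> gvars G"
    using f by (auto simp: gvars_def)
  \<comment> \<open>Once squares are expanded, all six fundamental binomials are differences of two
    products of two variables.\<close>
  have pair: "Var a * Var b - Var c * Var d \<in> (toric_ideal G :: ('v, 'e, 'k) gpoly set)"
    if "{a, b, c, d} \<subseteq> gvars G" "gvar_weight G a + gvar_weight G b = gvar_weight G c + gvar_weight G d" for a b c d
    using binomial_in_toric_ideal[of "{#a, b#}" G "{#c, d#}"] that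
    by (simp add: mset_monom_add_mset)
  from p show "p \<in> toric_ideal G"
    unfolding power2_eq_square
    by (elim insertE emptyE; simp only:; intro pair; simp add: gv f)
qed

text \<open>Only the last index wraps around, to 0; the others shift by one.\<close>

lemma sum_rotate:
  fixes h :: "nat \<Rightarrow> 'a::comm_monoid_add"
  shows "(\<Sum>k<n. h (Suc k mod n)) = (\<Sum>k<n. h k)"
proof (cases n)
  case (Suc m)
  have "(\<Sum>k<Suc m. h (Suc k mod Suc m)) = (\<Sum>k<m. h (Suc k)) + h 0"
    by simp
  also have "\<dots> = (\<Sum>k<Suc m. h k)"
    by (simp only: sum.lessThan_Suc_shift add.commute)
  finally show ?thesis by (simp only: Suc)
qed simp

text \<open>Whatever its block, an edge from \<open>i\<close> to \<open>j\<close> has a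
  \<open>fwd\<close> weight exceeding its \<open>bwd\<close> weight by the difference of the unit
  vectors of \<open>i\<close> and \<open>j\<close>; around a cycle these differences sum to
  zero.\<close>

lemma cyclic_binomial_toric:
  assumes G: "is_graph G" and "cyclic_pair G E\<^sub>1 E\<^sub>2"
  shows "(cyclic_binomial E\<^sub>1 E\<^sub>2 :: ('v, 'e, 'k::field) gpoly) \<in> toric_ideal G"
proof -
  obtain vs es C\<^sub>1 C\<^sub>2 where c: "is_cycle G vs es" and C: "C\<^sub>1 \<union> C\<^sub>2 = set es" "C\<^sub>1 \<inter> C\<^sub>2 = {}"
    and E1: "E\<^sub>1 = {(vs ! k, vs ! (Suc k mod length vs), es ! k) | k. k < length es \<and> es ! k \<in> C\<^sub>1}"
    and E2: "E\<^sub>2 = {(vs ! (Suc k mod length vs), vs ! k, es ! k) | k. k < length es \<and> es ! k \<in> C\<^sub>2}"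
    using assms(2) unfolding cyclic_pair_def by blast
  define n where "n = length es"
  define t where "t k = (vs ! k, vs ! (Suc k mod length vs), es ! k)" for k
  define S where "S = {d :: ('v, 'e) dedge. snd (snd d) \<in> C\<^sub>1}"
  define A where "A = t ` {..<n}"
  have len: "length vs = n" and de: "distinct es"
    and edge: "\<And>k. k < n \<Longrightarrow> es ! k \<in> edges G \<and> ends G (es ! k) = {#vs ! k, vs ! (Suc k mod n)#}"
    using c by (auto simp: is_cycle_def n_def)
  have C2: "es ! k \<in> C\<^sub>2 \<longleftrightarrow> es ! k \<notin> C\<^sub>1" if "k < n" for k
    using C nth_mem[of k es] that unfolding n_def by blast
  have S: "t k \<in> S \<longleftrightarrow> es ! k \<in> C\<^sub>1" for k
    by (simp add: t_def S_def)
  have "E\<^sub>1 = t ` {k. k < n \<and> es ! k \<in> C\<^sub>1}"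
    unfolding E1 t_def n_def by (rule setcompr_eq_image)
  also have "\<dots> = A \<inter> S"
    unfolding A_def using S by blast
  finally have E1': "E\<^sub>1 = A \<inter> S" .
  have "E\<^sub>2 = (\<lambda>k. flip (t k)) ` {k. k < n \<and> es ! k \<in> C\<^sub>2}"
    unfolding E2 t_def n_def flip_def prod.case by (rule setcompr_eq_image)
  then have E2': "E\<^sub>2 = flip ` (A - S)"
    unfolding A_def using S C2 by blast
  \<comment> \<open>Distinct edges let sums over \<open>A\<close> be taken over positions of the
    cycle, where the rotation of indices applies.\<close>
  have "inj_on t {..<n}"
    using de by (auto simp: inj_on_def t_def n_def nth_eq_iff_index_eq)
  then have sum_A: "(\<Sum>x\<in>#image_mset h (mset_set A). gvar_weight G x) = (\<Sum>k<n. gvar_weight G (h (t k)))" for h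
    by (simp add: A_def sum_unfold_sum_mset image_mset_mset_set[symmetric] multiset.map_comp o_def)
  have gw: "gvar_weight G (fwd S (t k)) = gvar_weight G (bwd S (t k))
      + (Poly_Mapping.single (Inl (vs ! k)) 1 - Poly_Mapping.single (Inl (vs ! (Suc k mod n))) 1)" for k
    by (simp add: t_def fwd_def bwd_def len)
  have weight: "weight G (image_mset (fwd S) (mset_set A)) = weight G (image_mset (bwd S) (mset_set A))"
    unfolding weight_def sum_A gw sum.distrib sum_subtractf
    using sum_rotate[of "\<lambda>k. Poly_Mapping.single (Inl (vs ! k) :: 'v + 'e) (1::int)" n] by simp
  have gv: "fwd S a \<in> gvars G \<and> bwd S a \<in> gvars G" if "a \<in> A" for a
  proof -
    obtain i j f where a: "a = (i, j, f)" by (cases a)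
    with that edge have "f \<in> edges G" "ends G f = {#i, j#}" "ends G f = {#j, i#}"
      by (auto simp: A_def t_def len add_mset_commute)
    then show ?thesis by (auto simp: a fwd_def bwd_def gvars_def)
  qed
  have "finite A" by (simp add: A_def)
  then show ?thesis
    unfolding E1' E2' cyclic_binomial_eq[OF \<open>finite A\<close>]
    using gv weight by (intro binomial_in_toric_ideal) auto
qed

theorem theorem2p5:
  fixes G :: "('v, 'e) multigraph"
  assumes "is_graph G"
  shows "(\<forall>u v E\<^sub>1 E\<^sub>2. zigzag_pair G u v E\<^sub>1 E\<^sub>2 \<longrightarrow>
             (zigzag_binomial u v E\<^sub>1 E\<^sub>2 :: ('v, 'e, 'k::field) gpoly)
               \<in> Idl\<^bsub>graph_ring G\<^esub> (fundamental_binomials G))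
       \<and> (toric_ideal G :: ('v, 'e, 'k) gpoly set) =
           Idl\<^bsub>graph_ring G\<^esub>
             (fundamental_binomials G \<union> {cyclic_binomial E\<^sub>1 E\<^sub>2 | E\<^sub>1 E\<^sub>2. cyclic_pair G E\<^sub>1 E\<^sub>2})"
proof -
  interpret R: ring "graph_ring G :: ('v, 'e, 'k) gpoly ring"
    using cring.axioms(1)[OF cring_ring_in] by (simp add: graph_ring_def)
  let ?F = "fundamental_binomials G :: ('v, 'e, 'k) gpoly set"
  let ?C = "{cyclic_binomial E\<^sub>1 E\<^sub>2 | E\<^sub>1 E\<^sub>2. cyclic_pair G E\<^sub>1 E\<^sub>2} :: ('v, 'e, 'k) gpoly set"
  have toric: "?F \<union> ?C \<subseteq> toric_ideal G"
    using fundamental_binomials_toric[OF assms] cyclic_binomial_toric[OF assms] by blast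
  then have carrier: "?F \<union> ?C \<subseteq> carrier (graph_ring G)"
    using toric_ideal_iff by blast
  \<comment> \<open>The zig-zag claim concerns the ideal of the fundamental binomials alone.\<close>
  have F: "fundamental_ideal G (Idl\<^bsub>graph_ring G\<^esub> ?F)"
    using carrier by (intro fundamental_ideal.intro assms R.genideal_ideal R.genideal_self) auto
  have min: "Idl\<^bsub>graph_ring G\<^esub> (?F \<union> ?C) \<subseteq> toric_ideal G"
    by (rule R.genideal_minimal[OF toric_ideal_ideal[OF assms] toric])
  have self: "?F \<union> ?C \<subseteq> Idl\<^bsub>graph_ring G\<^esub> (?F \<union> ?C)"
    by (rule R.genideal_self[OF carrier])
  \<comment> \<open>The inclusion \<open>min\<close> already supplies the locale assumption
    \<open>toric\<close>; the locale then returns the opposite inclusion.\<close>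
  have "cyclic_ideal G (Idl\<^bsub>graph_ring G\<^esub> (?F \<union> ?C))"
  proof (intro cyclic_ideal.intro fundamental_ideal.intro cyclic_ideal_axioms.intro)
    show "ideal (Idl\<^bsub>graph_ring G\<^esub> (?F \<union> ?C)) (graph_ring G)"
      by (rule R.genideal_ideal[OF carrier])
  qed (use assms min self in blast)+
  from cyclic_ideal.toric_ideal_subset[OF this] min
  show ?thesis
    using fundamental_ideal.zigzag_binomial_in_ideal[OF F] by blast
qed

end
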